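(* Let $n\ge 2$ and let $f\in\mathbb{C}[X_1,\ldots,X_n]$ be an irreducible polynomial with $L(f)=\mathbb{Z}^n$. Then for some $m$ with $1\le m\le 2^{n+1}-1$ there exist $m$ polynomials $f_1,\ldots,f_m\in\mathbb{C}[X_1,\ldots,X_n]$ such that: (i) $\deg(f_i)\le 2\deg(f)$ for $i=1,\ldots,m$; (ii) for each $1\le i\le m$, $f$ and $f_i$ have no common factor; (iii) for every torsion coset $C$ lying on the hypersurface $\mathcal{H}(f)$ there exists some $i$, $1\le i\le m$, such that $C$ also lies on the hypersurface $\mathcal{H}(f_i)$.
   Context: For a Laurent polynomial $f=\sum_{\boldsymbol i\in\mathbb{Z}^n}a_{\boldsymbol i}\boldsymbol X^{\boldsymbol i}$ (with $\boldsymbol X^{\boldsymbol i}=X_1^{i_1}\cdots X_n^{i_n}$), its support is $S_f=\{\boldsymbol i: a_{\boldsymbol i}\neq 0\}$ and its exponent lattice $L(f)$ is the subgroup of $\mathbb{Z}^n$ generated by the difference set $S_f-S_f$. $\mathbb{G}_{\rm m}^n$ is the complex algebraic torus $\{x\in\mathbb{C}^n: x_1\cdots x_n\neq0\}$ with coordinatewise multiplication; $\mathcal{H}(g)$ denotes the zero set of $g$ in $\mathbb{G}_{\rm m}^n$. A subtorus is a geometrically irreducible Zariski closed subgroup of $\mathbb{G}_{\rm m}^n$; a torsion coset is a coset $\boldsymbol\omega H$ with $H$ a subtorus and $\boldsymbol\omega$ a point whose coordinates are roots of unity. $\deg$ denotes total degree. *)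

theory Defs
  imports
    "HOL-Library.Poly_Mapping"
    "HOL-Computational_Algebra.Factorial_Ring"
    "HOL-Computational_Algebra.Group_Closure"
    "HOL-Algebra.Coset"
    "HOL-Analysis.Finite_Cartesian_Product"
begin

text \<open>
  The ring \<open>\<complex>[X\<^sub>1, \<dots>, X\<^sub>n]\<close> is the monoid ring of \<open>\<nat>\<^sup>n\<close> over \<open>\<complex>\<close>: the variables are indexed by a
  finite type \<open>'n\<close> with \<open>CARD('n) = n\<close>, and the coefficient of \<open>X\<^bsup>m\<^esup>\<close> in \<open>p\<close> is \<open>Poly_Mapping.lookup p m\<close>.
\<close>

type_synonym 'n mpoly = "('n \<Rightarrow>\<^sub>0 nat) \<Rightarrow>\<^sub>0 complex"

definition total_degree :: "'n::finite mpoly \<Rightarrow> nat" where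
  "total_degree p =
     Max (insert 0 ((\<lambda>m. \<Sum>i\<in>UNIV. Poly_Mapping.lookup m i) ` Poly_Mapping.keys p))"

definition poly_eval :: "'n::finite mpoly \<Rightarrow> complex ^ 'n \<Rightarrow> complex" where
  "poly_eval p x =
     (\<Sum>m\<in>Poly_Mapping.keys p. Poly_Mapping.lookup p m * (\<Prod>i\<in>UNIV. (x $ i) ^ Poly_Mapping.lookup m i))"

definition support :: "'n::finite mpoly \<Rightarrow> (int ^ 'n) set" where
  "support p = (\<lambda>m. \<chi> i. int (Poly_Mapping.lookup m i)) ` Poly_Mapping.keys p"

definition exponent_lattice :: "'n::finite mpoly \<Rightarrow> (int ^ 'n) set" where
  "exponent_lattice p = group_closure {a - b | a b. a \<in> support p \<and> b \<in> support p}"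

text \<open>Multiplication and unit of type \<open>complex ^ 'n\<close> are coordinatewise.\<close>

definition torus :: "(complex ^ 'n::finite) monoid" where
  "torus = \<lparr>carrier = {x. \<forall>i. x $ i \<noteq> 0}, mult = (*), one = 1\<rparr>"

definition hypersurface :: "'n::finite mpoly \<Rightarrow> (complex ^ 'n) set" where
  "hypersurface p = {x \<in> carrier torus. poly_eval p x = 0}"

text \<open>
  Polynomials cut out the same subsets of the torus as Laurent polynomials do, since
  monomials vanish nowhere on it. The empty family gives the whole torus.
\<close>

definition zariski_closed :: "(complex ^ 'n::finite) set \<Rightarrow> bool" where
  "zariski_closed Z \<longleftrightarrow> (\<exists>P. Z = {x \<in> carrier torus. \<forall>p\<in>P. poly_eval p x = 0})"

text \<open>As \<open>\<complex>\<close> is algebraically closed, irreducibility and geometric irreducibility agree.\<close>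

definition zariski_irreducible :: "(complex ^ 'n::finite) set \<Rightarrow> bool" where
  "zariski_irreducible Z \<longleftrightarrow> Z \<noteq> {} \<and>
     (\<forall>A B. zariski_closed A \<and> zariski_closed B \<and> Z \<subseteq> A \<union> B \<longrightarrow> Z \<subseteq> A \<or> Z \<subseteq> B)"

definition subtorus :: "(complex ^ 'n::finite) set \<Rightarrow> bool" where
  "subtorus H \<longleftrightarrow> subgroup H torus \<and> zariski_closed H \<and> zariski_irreducible H"

definition torsion_coset :: "(complex ^ 'n::finite) set \<Rightarrow> bool" where
  "torsion_coset C \<longleftrightarrow>
     (\<exists>w H. (\<forall>i. \<exists>k>0. (w $ i) ^ k = 1) \<and> subtorus H \<and> C = w <#\<^bsub>torus\<^esub> H)"

end

theory Submission
  imports Defs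
    "HOL-Computational_Algebra.Polynomial_Factorial"
    "HOL-Number_Theory.Cong"
begin

text \<open>
  A polynomial \<open>\<Sum> c\<^sub>m X\<^sup>m\<close> vanishes on \<open>\<omega> H\<close> if and only if \<open>\<Sum> c\<^sub>m \<omega>\<^sup>m = 0\<close> over each class of exponents
  that agree as characters of \<open>H\<close>. So an additive map of the coefficients that respects linear relations
  among roots of unity carries torsion cosets on \<open>f = 0\<close> to torsion cosets on the new hypersurface; neither
  automorphisms of \<open>\<complex>\<close> nor the density of torsion points is needed.

  If no multiple of \<open>f\<close> has its coefficients in the ring \<open>K\<close> generated by the roots of unity, a
  \<open>K\<close>-linear form that kills one coefficient of \<open>f\<close> and not another gives a single polynomial. Otherwise,
  after a torsion translation and a rescaling, the coefficients lie in \<open>\<int>[\<zeta>\<^sub>N]\<close> with \<open>N\<close> minimal, so that \<open>N\<close>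
  is odd or divisible by 4. Every \<open>\<omega>\<close> has a conjugate, over \<open>\<zeta>\<^sub>N \<mapsto> \<zeta>\<^sub>N\<close>, \<open>-\<zeta>\<^sub>N\<close> or \<open>\<zeta>\<^sub>N\<^sup>2\<close>, of the form
  \<open>\<epsilon> \<omega>\<close> or \<open>\<epsilon> \<omega>\<^sup>2\<close> with a vector of signs \<open>\<epsilon>\<close>. This gives the polynomials \<open>f(\<epsilon> X)\<close> with \<open>\<epsilon> \<noteq> 1\<close>,
  together with the \<open>f\<^sup>\<sigma>(\<epsilon> X\<^sup>2)\<close> for odd \<open>N\<close>, or the \<open>f\<^sup>\<sigma>(\<epsilon> X)\<close> when 4 divides \<open>N\<close>. That \<open>f\<close> divides
  none of them follows from \<open>L(f) = \<int>\<^sup>n\<close>, from the minimality of \<open>N\<close>, and, for \<open>f\<^sup>\<sigma>(\<epsilon> X\<^sup>2)\<close>, from unique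
  factorisation.
\<close>

section \<open>Gauss's lemma for subdomains\<close>

text \<open>Domains are carried as subsets of a ring type, because the later induction adds one
  variable at a time inside a single type of polynomials.\<close>

locale subdomain =
  fixes A :: "'a::comm_ring_1 set"
  assumes one: "1 \<in> A"
    and diff: "\<And>a b. a \<in> A \<Longrightarrow> b \<in> A \<Longrightarrow> a - b \<in> A"
    and mult: "\<And>a b. a \<in> A \<Longrightarrow> b \<in> A \<Longrightarrow> a * b \<in> A"
    and no_zero_divisors: "\<And>a b. a \<in> A \<Longrightarrow> b \<in> A \<Longrightarrow> a * b = 0 \<Longrightarrow> a = 0 \<or> b = 0"
begin

lemma zero: "0 \<in> A"
  using diff[OF one one] by simp

lemma minus: "a \<in> A \<Longrightarrow> - a \<in> A"
  using diff[OF zero] by fastforce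

lemma add: "a \<in> A \<Longrightarrow> b \<in> A \<Longrightarrow> a + b \<in> A"
  using diff[of a "- b"] minus by simp

lemma sum: "(\<And>i. i \<in> I \<Longrightarrow> g i \<in> A) \<Longrightarrow> sum g I \<in> A"
  by (induction I rule: infinite_finite_induct) (auto intro: zero add)

lemma cancel: "a \<in> A \<Longrightarrow> b \<in> A \<Longrightarrow> c \<in> A \<Longrightarrow> a \<noteq> 0 \<Longrightarrow> a * b = a * c \<Longrightarrow> b = c"
  using no_zero_divisors[of a "b - c"] diff[of b c] by (simp add: right_diff_distrib)

end

definition dvd_on :: "'a::comm_ring_1 set \<Rightarrow> 'a \<Rightarrow> 'a \<Rightarrow> bool" where
  "dvd_on A a b \<longleftrightarrow> (\<exists>c\<in>A. b = a * c)"

definition unit_on :: "'a::comm_ring_1 set \<Rightarrow> 'a \<Rightarrow> bool" where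
  "unit_on A a \<longleftrightarrow> a \<in> A \<and> dvd_on A a 1"

definition irreducible_on :: "'a::comm_ring_1 set \<Rightarrow> 'a \<Rightarrow> bool" where
  "irreducible_on A p \<longleftrightarrow> p \<in> A \<and> p \<noteq> 0 \<and> \<not> unit_on A p \<and>
     (\<forall>a\<in>A. \<forall>b\<in>A. p = a * b \<longrightarrow> unit_on A a \<or> unit_on A b)"

definition prime_on :: "'a::comm_ring_1 set \<Rightarrow> 'a \<Rightarrow> bool" where
  "prime_on A p \<longleftrightarrow> p \<in> A \<and> p \<noteq> 0 \<and> \<not> unit_on A p \<and>
     (\<forall>a\<in>A. \<forall>b\<in>A. dvd_on A p (a * b) \<longrightarrow> dvd_on A p a \<or> dvd_on A p b)"

text \<open>The additive length \<open>\<delta>\<close> replaces the number of prime factors, so that neither existence nor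
  uniqueness of factorisations has to be carried through Gauss's lemma.\<close>

locale factorial_subdomain = subdomain A for A :: "'a::comm_ring_1 set" +
  fixes \<delta> :: "'a \<Rightarrow> nat"
  assumes length_mult: "\<And>a b. a \<in> A \<Longrightarrow> b \<in> A \<Longrightarrow> a \<noteq> 0 \<Longrightarrow> b \<noteq> 0 \<Longrightarrow> \<delta> (a * b) = \<delta> a + \<delta> b"
    and length_zero: "\<And>a. a \<in> A \<Longrightarrow> a \<noteq> 0 \<Longrightarrow> \<delta> a = 0 \<Longrightarrow> unit_on A a"
    and irreducible_prime: "\<And>a. irreducible_on A a \<Longrightarrow> prime_on A a"

lemma (in factorial_subdomain) prime_divisor:
  assumes "c \<in> A" "c \<noteq> 0" "\<not> unit_on A c"
  shows "\<exists>p x. prime_on A p \<and> x \<in> A \<and> c = p * x \<and> x \<noteq> 0 \<and> \<delta> x < \<delta> c"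
  using assms
proof (induction "\<delta> c" arbitrary: c rule: less_induct)
  case less
  show ?case
  proof (cases "irreducible_on A c")
    case True
    have "\<delta> 1 = 0" using length_mult[of 1 1] one by simp
    moreover have "\<delta> c \<noteq> 0" using less.prems length_zero by blast
    ultimately show ?thesis
      using True irreducible_prime one by (intro exI[of _ c] exI[of _ 1]) auto
  next
    case False
    then obtain a b where ab: "a \<in> A" "b \<in> A" "c = a * b" "\<not> unit_on A a" "\<not> unit_on A b"
      using less.prems by (auto simp: irreducible_on_def)
    then have nz: "a \<noteq> 0" "b \<noteq> 0" using less.prems by auto
    have "\<delta> b \<noteq> 0" "\<delta> a \<noteq> 0" using ab nz length_zero by blast+
    then have "\<delta> a < \<delta> c" using length_mult ab nz by simp
    then obtain p x where px: "prime_on A p" "x \<in> A" "a = p * x" "x \<noteq> 0" "\<delta> x < \<delta> a"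
      using less.hyps[of a] ab nz by blast
    then have "x * b \<noteq> 0" using no_zero_divisors[of x b] ab nz by blast
    then show ?thesis using px ab nz length_mult[of x b] length_mult[of a b] mult[of x b]
      by (intro exI[of _ p] exI[of _ "x * b"]) (auto simp: mult.assoc)
  qed
qed

section \<open>Polynomials over a subdomain and Gauss's lemma\<close>

definition polys :: "'a::zero set \<Rightarrow> 'a poly set" where
  "polys A = {p. \<forall>i. coeff p i \<in> A}"

context subdomain
begin

lemma const_polys [simp]: "[:a:] \<in> polys A \<longleftrightarrow> a \<in> A"
  using zero by (auto simp: polys_def coeff_pCons split: nat.splits)

lemma monom_polys: "a \<in> A \<Longrightarrow> monom a n \<in> polys A"
  using zero by (auto simp: polys_def)

text \<open>The ambient type may have zero divisors; the product of the leading coefficients is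
  nonzero because both lie in \<open>A\<close>.\<close>

lemma degree_mult_polys:
  assumes "p \<in> polys A" "q \<in> polys A" "p \<noteq> 0" "q \<noteq> 0"
  shows "degree (p * q) = degree p + degree q" "lead_coeff (p * q) = lead_coeff p * lead_coeff q"
    "p * q \<noteq> 0"
proof -
  have 1: "coeff (p * q) (degree p + degree q) = lead_coeff p * lead_coeff q"
    by (rule coeff_mult_degree_sum)
  also have "\<dots> \<noteq> 0" using assms no_zero_divisors[of "lead_coeff p" "lead_coeff q"] by (auto simp: polys_def)
  finally have 2: "coeff (p * q) (degree p + degree q) \<noteq> 0" .
  then show 3: "degree (p * q) = degree p + degree q"
    using degree_mult_le le_degree by (metis antisym)
  show "lead_coeff (p * q) = lead_coeff p * lead_coeff q" "p * q \<noteq> 0"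
    using 1 2 3 by auto
qed

lemma subdomain_polys: "subdomain (polys A)"
proof
  show "1 \<in> polys A" using one by (simp add: one_pCons)
  show "p - q \<in> polys A" if "p \<in> polys A" "q \<in> polys A" for p q
    using that diff by (auto simp: polys_def)
  show "p * q \<in> polys A" if "p \<in> polys A" "q \<in> polys A" for p q
    using that by (auto simp: polys_def coeff_mult intro!: sum mult)
  show "p = 0 \<or> q = 0" if "p \<in> polys A" "q \<in> polys A" "p * q = 0" for p q
    using degree_mult_polys(3)[of p q] that by auto
qed

interpretation poly: subdomain "polys A"
  by (rule subdomain_polys)

lemma dvd_on_const:
  assumes "c \<in> A" "c \<noteq> 0" "p \<in> polys A"
  shows "dvd_on (polys A) [:c:] p \<longleftrightarrow> (\<forall>i. dvd_on A c (coeff p i))"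
proof
  assume "\<forall>i. dvd_on A c (coeff p i)"
  then have "\<forall>i. \<exists>q. q \<in> A \<and> coeff p i = c * q" unfolding dvd_on_def by blast
  then obtain q where "\<forall>i. q i \<in> A \<and> coeff p i = c * q i" unfolding choice_iff by blast
  then have q: "q i \<in> A" "coeff p i = c * q i" for i by simp_all
  have p: "p = [:c:] * (\<Sum>i\<le>degree p. monom (q i) i)"
  proof (rule poly_eqI)
    fix i
    show "coeff p i = coeff ([:c:] * (\<Sum>i\<le>degree p. monom (q i) i)) i"
      using coeff_eq_0[of p i] q(2)[of i] by (cases "i \<le> degree p") (simp_all add: coeff_sum)
  qed
  show "dvd_on (polys A) [:c:] p"
    unfolding dvd_on_def using p by (rule bexI) (intro poly.sum monom_polys q)
next
  assume "dvd_on (polys A) [:c:] p"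
  then obtain q where "q \<in> polys A" "p = [:c:] * q" unfolding dvd_on_def by blast
  then show "\<forall>i. dvd_on A c (coeff p i)" unfolding dvd_on_def polys_def by auto
qed

lemma degree_0_polys: "p \<in> polys A \<Longrightarrow> degree p = 0 \<Longrightarrow> \<exists>a\<in>A. p = [:a:]"
  using const_polys by (elim degree_eq_zeroE) auto

lemma unit_on_polys: "unit_on (polys A) p \<longleftrightarrow> (\<exists>a. p = [:a:] \<and> unit_on A a)"
proof
  assume "unit_on (polys A) p"
  then obtain q where pq: "p \<in> polys A" "q \<in> polys A" "p * q = 1"
    by (auto simp: unit_on_def dvd_on_def)
  then have nz: "p \<noteq> 0" "q \<noteq> 0" by auto
  have "degree p + degree q = 0" using degree_mult_polys(1)[OF pq(1,2) nz] pq(3) by simp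
  then obtain a b where ab: "a \<in> A" "b \<in> A" "p = [:a:]" "q = [:b:]"
    using degree_0_polys pq by (metis add_is_0)
  then have "a * b = 1" using pq(3) by (simp add: one_pCons mult.commute)
  then show "\<exists>a. p = [:a:] \<and> unit_on A a" using ab by (metis dvd_on_def unit_on_def)
next
  assume "\<exists>a. p = [:a:] \<and> unit_on A a"
  then obtain a b where "p = [:a:]" "a \<in> A" "b \<in> A" "a * b = 1"
    by (auto simp: unit_on_def dvd_on_def)
  then show "unit_on (polys A) p"
    by (auto simp: unit_on_def dvd_on_def one_pCons intro!: bexI[of _ "[:b:]"])
qed

lemma dvd_on_diff: "dvd_on A p a \<Longrightarrow> dvd_on A p b \<Longrightarrow> dvd_on A p (a - b)"
  using diff by (metis dvd_on_def right_diff_distrib)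

lemma dvd_on_sum: "(\<And>i. i \<in> I \<Longrightarrow> dvd_on A p (g i)) \<Longrightarrow> dvd_on A p (sum g I)"
proof (induction I rule: infinite_finite_induct)
  case (insert i I)
  then have "dvd_on A p (g i)" "dvd_on A p (sum g I)" by auto
  then obtain a b where "a \<in> A" "b \<in> A" "g i = p * a" "sum g I = p * b"
    unfolding dvd_on_def by blast
  then have "sum g (insert i I) = p * (a + b)" "a + b \<in> A"
    using insert add by (auto simp: distrib_left)
  then show ?case unfolding dvd_on_def by blast
qed (use zero in \<open>auto simp: dvd_on_def intro!: bexI[of _ 0]\<close>)

text \<open>Take the first coefficients of \<open>g\<close> and \<open>h\<close>, at
  \<open>i\<close> and \<open>j\<close>, that \<open>p\<close> does not divide. Modulo
  \<open>p\<close>, the coefficient of \<open>g * h\<close> at \<open>i + j\<close> is their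
  product, since every other term of the convolution has an index below \<open>i\<close> or below
  \<open>j\<close>.\<close>

lemma prime_on_const:
  assumes "prime_on A p"
  shows "prime_on (polys A) [:p:]"
proof -
  have p: "p \<in> A" "p \<noteq> 0" using assms by (auto simp: prime_on_def)
  have "dvd_on (polys A) [:p:] g \<or> dvd_on (polys A) [:p:] h"
    if gh: "g \<in> polys A" "h \<in> polys A" "dvd_on (polys A) [:p:] (g * h)" for g h
  proof (rule ccontr)
    assume contra: "\<not> ?thesis"
    define i where "i = (LEAST i. \<not> dvd_on A p (coeff g i))"
    define j where "j = (LEAST j. \<not> dvd_on A p (coeff h j))"
    have i: "\<not> dvd_on A p (coeff g i)" and j: "\<not> dvd_on A p (coeff h j)"
      unfolding i_def j_def using contra dvd_on_const[OF p gh(1)] dvd_on_const[OF p gh(2)]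
      by (intro LeastI_ex[of "\<lambda>i. \<not> dvd_on A p (coeff _ i)"]; blast)+
    have *: "dvd_on A p (coeff g k * coeff h (i + j - k))" if "k \<in> {..i + j} - {i}" for k
    proof (cases "k < i")
      case True
      then have "dvd_on A p (coeff g k)" unfolding i_def using not_less_Least by blast
      then obtain x where "x \<in> A" "coeff g k = p * x" by (auto simp: dvd_on_def)
      moreover have "x * coeff h (i + j - k) \<in> A" using \<open>x \<in> A\<close> gh(2) mult by (simp add: polys_def)
      ultimately show ?thesis unfolding dvd_on_def by (intro bexI[of _ "x * coeff h (i + j - k)"]) (simp_all only: mult.assoc)
    next
      case False
      then have "i + j - k < j" using that by auto
      then have "dvd_on A p (coeff h (i + j - k))" unfolding j_def using not_less_Least by blast
      then obtain x where "x \<in> A" "coeff h (i + j - k) = p * x" by (auto simp: dvd_on_def)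
      moreover have "coeff g k * x \<in> A" using \<open>x \<in> A\<close> gh(1) mult by (simp add: polys_def)
      ultimately show ?thesis unfolding dvd_on_def by (intro bexI[of _ "coeff g k * x"]) (simp_all only: mult.left_commute)
    qed
    have "coeff (g * h) (i + j) = coeff g i * coeff h j +
        (\<Sum>k\<in>{..i + j} - {i}. coeff g k * coeff h (i + j - k))"
      unfolding coeff_mult by (subst sum.remove[of _ i]) auto
    then have eq: "coeff g i * coeff h j = coeff (g * h) (i + j) -
        (\<Sum>k\<in>{..i + j} - {i}. coeff g k * coeff h (i + j - k))" by simp
    have "dvd_on A p (coeff (g * h) (i + j))"
      using dvd_on_const[OF p poly.mult[OF gh(1,2)]] gh(3) by blast
    then have "dvd_on A p (coeff g i * coeff h j)"
      unfolding eq by (intro dvd_on_diff dvd_on_sum *)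
    then show False using assms i j gh by (auto simp: prime_on_def polys_def)
  qed
  moreover have "\<not> unit_on (polys A) [:p:]"
    using assms by (auto simp: prime_on_def unit_on_polys)
  ultimately show ?thesis
    using p unfolding prime_on_def by simp
qed

text \<open>The leading coefficient of \<open>d\<close> may fail to be a unit of \<open>A\<close>,
  so each elimination step first multiplies the dividend by it; \<open>c\<close> collects these
  factors.\<close>

lemma pseudo_division:
  assumes "d \<in> polys A" "d \<noteq> 0" "f \<in> polys A"
  shows "\<exists>c\<in>A. \<exists>q\<in>polys A. \<exists>r\<in>polys A. c \<noteq> 0 \<and> [:c:] * f = d * q + r \<and> (r = 0 \<or> degree r < degree d)"
  using assms(3)
proof (induction "degree f" arbitrary: f rule: less_induct)
  case less
  let ?l = "lead_coeff d"
  have l: "?l \<in> A" "?l \<noteq> 0" using assms by (auto simp: polys_def)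
  show ?case
  proof (cases "f = 0 \<or> degree f < degree d")
    case True
    then show ?thesis using less.prems one poly.zero
      by (intro bexI[of _ 1] bexI[of _ 0] bexI[of _ f]) auto
  next
    case False
    define m where "m = monom (lead_coeff f) (degree f - degree d)"
    have m: "m \<in> polys A" using less.prems monom_polys by (auto simp: m_def polys_def)
    have m0: "m \<noteq> 0" using False by (simp add: m_def)
    define g where "g = [:?l:] * f - d * m"
    have g: "g \<in> polys A" unfolding g_def
      using m l less.prems assms by (intro poly.diff poly.mult) (simp_all only: const_polys not_False_eq_True)
    have lf: "[:?l:] * f \<noteq> 0 \<and> degree ([:?l:] * f) = degree f \<and> lead_coeff ([:?l:] * f) = ?l * lead_coeff f"
      using degree_mult_polys[of "[:?l:]" f] l less.prems False by auto
    have dm: "degree (d * m) = degree f \<and> lead_coeff (d * m) = ?l * lead_coeff f"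
      using degree_mult_polys[of d m] m m0 assms False by (simp add: m_def degree_monom_eq)
    \<comment> \<open>For constant \<open>f\<close> no smaller degree is available; there the first
      elimination already leaves zero.\<close>
    have *: "g = 0 \<or> degree g < degree f"
    proof (cases "degree f = 0")
      case True
      then have "degree ([:?l:] * f) = 0" "degree (d * m) = 0" using lf dm by simp_all
      then have "g = 0" using lf dm unfolding g_def
        by (elim conjE degree_eq_zeroE[of "[:?l:] * f"] degree_eq_zeroE[of "d * m"]) simp_all
      then show ?thesis by simp
    next
      case False
      have "degree g \<le> degree f" unfolding g_def using lf dm by (simp add: degree_diff_le)
      moreover have "coeff g (degree f) = 0" unfolding g_def using lf dm by (metis coeff_diff right_minus_eq)
      ultimately show ?thesis by (metis False bot_nat_0.not_eq_extremum eq_zero_or_degree_less)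
    qed
    show ?thesis
    proof (cases "g = 0")
      case True
      then have "[:?l:] * f = d * m + 0" by (simp add: g_def)
      then show ?thesis using l m poly.zero by blast
    next
      case False
      then obtain c q r where cqr: "c \<in> A" "q \<in> polys A" "r \<in> polys A" "c \<noteq> 0"
        "[:c:] * g = d * q + r" "r = 0 \<or> degree r < degree d"
        using less.hyps[of g] g * by blast
      have "[:c * ?l:] = [:c:] * [:?l:]" by simp
      then have "[:c * ?l:] * f = [:c:] * (g + d * m)"
        unfolding g_def by (simp only: mult.assoc diff_add_cancel)
      also have "\<dots> = d * (q + [:c:] * m) + r"
        by (simp only: distrib_left cqr(5) mult.left_commute[of "[:c:]" d] add_ac)
      finally have 1: "[:c * ?l:] * f = d * (q + [:c:] * m) + r" .
      have "c * ?l \<noteq> 0" using no_zero_divisors cqr l by blast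
      moreover have "c * ?l \<in> A" using cqr l mult by blast
      moreover have "q + [:c:] * m \<in> polys A" using cqr m by (intro poly.add poly.mult) simp_all
      ultimately show ?thesis using 1 cqr by blast
    qed
  qed
qed

end

context factorial_subdomain
begin

interpretation poly: subdomain "polys A"
  by (rule subdomain_polys)

text \<open>Each prime factor of \<open>c\<close> divides \<open>d\<close> or \<open>e\<close> by
  Gauss's lemma and is cancelled there, so induction on the length distributes \<open>c\<close> over
  the two factors. This does the work of contents without gcds.\<close>

lemma split_const_factor:
  assumes "c \<in> A" "c \<noteq> 0" "d \<in> polys A" "e \<in> polys A" "f \<in> polys A" "d * e = [:c:] * f"
  shows "\<exists>c1\<in>A. \<exists>c2\<in>A. \<exists>d'\<in>polys A. \<exists>e'\<in>polys A. d = [:c1:] * d' \<and> e = [:c2:] * e' \<and> d' * e' = f"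
  using assms
proof (induction "\<delta> c" arbitrary: c d e rule: less_induct)
  case less
  show ?case
  proof (cases "unit_on A c")
    case True
    then obtain u where u: "u \<in> A" "1 = c * u" by (auto simp: unit_on_def dvd_on_def)
    have cu: "[:c:] * [:u:] = 1" using u by (simp add: one_pCons mult.commute)
    have 1: "e = [:c:] * ([:u:] * e)" by (simp only: mult.assoc[symmetric] cu mult_1)
    have "d * ([:u:] * e) = [:u:] * (d * e)" by (simp only: mult.left_commute)
    also have "\<dots> = f" by (simp only: less.prems(6) mult.assoc[symmetric] mult.commute[of "[:u:]"] cu mult_1)
    finally have 2: "d * ([:u:] * e) = f" .
    have 3: "[:u:] * e \<in> polys A" using u less.prems by (intro poly.mult) simp_all
    have "d = [:1:] * d" by simp
    then show ?thesis using less.prems(1,3) one 1 2 3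
      by (intro bexI[of _ 1] bexI[of _ c] bexI[of _ d] bexI[of _ "[:u:] * e"] conjI)
  next
    case False
    then obtain p x where px: "prime_on A p" "x \<in> A" "c = p * x" "x \<noteq> 0" "\<delta> x < \<delta> c"
      using prime_divisor less.prems by blast
    have pA: "p \<in> A" "p \<noteq> 0" using px by (auto simp: prime_on_def)
    then have pP: "[:p:] \<in> polys A" "[:p:] \<noteq> 0" by simp_all
    have cpx: "[:c:] = [:p:] * [:x:]" using px by simp
    have xf: "[:x:] * f \<in> polys A" using px less.prems by (intro poly.mult) auto
    have "d * e = [:p:] * ([:x:] * f)" using less.prems(6) cpx by (simp only: mult.assoc)
    then have "dvd_on (polys A) [:p:] (d * e)" using xf unfolding dvd_on_def by (rule bexI)
    then consider "dvd_on (polys A) [:p:] d" | "dvd_on (polys A) [:p:] e"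
      using prime_on_const[OF px(1)] less.prems unfolding prime_on_def by blast
    then show ?thesis
    proof cases
      case 1
      then obtain d0 where d0: "d0 \<in> polys A" "d = [:p:] * d0" by (auto simp: dvd_on_def)
      have "[:p:] * (d0 * e) = [:p:] * ([:x:] * f)"
        using less.prems(6) d0 cpx by (simp only: mult.assoc)
      then have "d0 * e = [:x:] * f"
        by (rule poly.cancel[OF pP(1) poly.mult[OF d0(1) less.prems(4)] xf pP(2)])
      then obtain c1 c2 d' e' where *: "c1 \<in> A" "c2 \<in> A" "d' \<in> polys A" "e' \<in> polys A"
        "d0 = [:c1:] * d'" "e = [:c2:] * e'" "d' * e' = f"
        using less.hyps[OF px(5,2,4) d0(1) less.prems(4,5)] by blast
      have "d = [:p * c1:] * d'" using d0 * by (simp add: mult_ac)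
      then show ?thesis using * mult pA by blast
    next
      case 2
      then obtain d0 where d0: "d0 \<in> polys A" "e = [:p:] * d0" by (auto simp: dvd_on_def)
      have "[:p:] * (d * d0) = [:p:] * ([:x:] * f)"
        using less.prems(6) d0 cpx by (simp only: mult.assoc mult.left_commute)
      then have "d * d0 = [:x:] * f"
        by (rule poly.cancel[OF pP(1) poly.mult[OF less.prems(3) d0(1)] xf pP(2)])
      then obtain c1 c2 d' e' where *: "c1 \<in> A" "c2 \<in> A" "d' \<in> polys A" "e' \<in> polys A"
        "d = [:c1:] * d'" "d0 = [:c2:] * e'" "d' * e' = f"
        using less.hyps[OF px(5,2,4) less.prems(3) d0(1) less.prems(5)] by blast
      have "e = [:p * c2:] * e'" using d0 * by (simp add: mult_ac)
      then show ?thesis using * mult pA by blast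
    qed
  qed
qed

text \<open>As no prime constant divides \<open>f\<close>, every prime factor of \<open>c\<close>
  must divide \<open>k\<close> and can be cancelled, until \<open>c\<close> is a unit.\<close>

lemma dvd_on_cancel_const:
  assumes "c \<in> A" "c \<noteq> 0" "f \<in> polys A" "g \<in> polys A" "k \<in> polys A" "[:c:] * g = f * k"
    and primitive: "\<And>p. prime_on A p \<Longrightarrow> \<not> dvd_on (polys A) [:p:] f"
  shows "dvd_on (polys A) f g"
  using assms(1-6)
proof (induction "\<delta> c" arbitrary: c k rule: less_induct)
  case less
  show ?case
  proof (cases "unit_on A c")
    case True
    then obtain u where u: "u \<in> A" "1 = c * u" by (auto simp: unit_on_def dvd_on_def)
    have cu: "[:c:] * [:u:] = 1" using u by (simp add: one_pCons mult.commute)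
    have "f * ([:u:] * k) = [:u:] * (f * k)" by (simp only: mult.left_commute)
    also have "\<dots> = g"
      by (simp only: less.prems(6)[symmetric] mult.assoc[symmetric] mult.commute[of "[:u:]"] cu mult_1)
    finally have "g = f * ([:u:] * k)" by (rule sym)
    moreover have "[:u:] * k \<in> polys A" using u less.prems by (intro poly.mult) simp_all
    ultimately show ?thesis unfolding dvd_on_def by blast
  next
    case False
    then obtain p x where px: "prime_on A p" "x \<in> A" "c = p * x" "x \<noteq> 0" "\<delta> x < \<delta> c"
      using prime_divisor less.prems by blast
    have pA: "p \<in> A" "p \<noteq> 0" using px by (auto simp: prime_on_def)
    then have pP: "[:p:] \<in> polys A" "[:p:] \<noteq> 0" by simp_all
    have cpx: "[:c:] = [:p:] * [:x:]" using px by simp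
    have xg: "[:x:] * g \<in> polys A" using px less.prems by (intro poly.mult) auto
    have 1: "[:p:] * ([:x:] * g) = f * k" using less.prems(6) cpx by (simp only: mult.assoc)
    then have "dvd_on (polys A) [:p:] (f * k)" using xg unfolding dvd_on_def by (intro bexI[of _ "[:x:] * g"]) simp_all
    then have "dvd_on (polys A) [:p:] k"
      using prime_on_const[OF px(1)] less.prems primitive[OF px(1)] unfolding prime_on_def by blast
    then obtain k0 where k0: "k0 \<in> polys A" "k = [:p:] * k0" by (auto simp: dvd_on_def)
    have "[:p:] * ([:x:] * g) = [:p:] * (f * k0)"
      using 1 k0 by (simp only: mult.left_commute)
    then have "[:x:] * g = f * k0"
      by (rule poly.cancel[OF pP(1) xg poly.mult[OF less.prems(3) k0(1)] pP(2)])
    then show ?thesis using less.hyps[OF px(5,2,4) less.prems(3,4) k0(1)] by blast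
  qed
qed

text \<open>A nonconstant irreducible \<open>f\<close> is primitive. An element \<open>d\<close> of
  least degree in the ideal of \<open>f\<close> and \<open>g\<close> plays the gcd over the fraction
  field: it divides constant multiples of both, and irreducibility of \<open>f\<close> leaves only
  \<open>d\<close> equal to \<open>f\<close> or to 1, up to constants.\<close>

lemma irreducible_polys_prime:
  assumes "irreducible_on (polys A) f"
  shows "prime_on (polys A) f"
proof (cases "degree f = 0")
  case True
  then obtain a where a: "a \<in> A" "f = [:a:]"
    using degree_0_polys[of f] assms unfolding irreducible_on_def by blast
  have "irreducible_on A a"
    unfolding irreducible_on_def
  proof (intro conjI ballI impI)
    show "a \<in> A" "a \<noteq> 0" "\<not> unit_on A a"
      using assms a unit_on_polys[of f] by (auto simp: irreducible_on_def)
    fix b c assume bc: "b \<in> A" "c \<in> A" "a = b * c"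
    then have "f = [:b:] * [:c:]" using a by simp
    then have "unit_on (polys A) [:b:] \<or> unit_on (polys A) [:c:]"
      using assms bc by (simp add: irreducible_on_def del: mult_pCons_left mult_pCons_right)
    then show "unit_on A b \<or> unit_on A c" by (auto simp: unit_on_polys)
  qed
  then show ?thesis using prime_on_const irreducible_prime a by blast
next
  case False
  have f: "f \<in> polys A" "f \<noteq> 0" "\<not> unit_on (polys A) f" using assms by (auto simp: irreducible_on_def)
  have f_fact: "degree g = 0 \<or> degree h = 0" if "g \<in> polys A" "h \<in> polys A" "f = g * h" for g h
  proof -
    have "unit_on (polys A) g \<or> unit_on (polys A) h" using that assms by (simp add: irreducible_on_def)
    then show ?thesis by (auto simp: unit_on_polys)
  qed
  have primitive: "\<not> dvd_on (polys A) [:p:] f" if "prime_on A p" for p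
  proof
    assume "dvd_on (polys A) [:p:] f"
    then obtain g where g: "g \<in> polys A" "f = [:p:] * g" by (auto simp: dvd_on_def)
    moreover have "p \<in> A" "\<not> unit_on A p" using that by (auto simp: prime_on_def)
    ultimately have "unit_on (polys A) g" using assms const_polys unit_on_polys[of "[:p:]"]
      by (metis irreducible_on_def pCons_eq_iff)
    then have "degree f = 0" using g by (auto simp: unit_on_polys)
    then show False using False by simp
  qed
  have "dvd_on (polys A) f g \<or> dvd_on (polys A) f h"
    if gh: "g \<in> polys A" "h \<in> polys A" "dvd_on (polys A) f (g * h)" for g h
  proof -
    define I where "I = {u * f + v * g | u v. u \<in> polys A \<and> v \<in> polys A}"
    have "f = 1 * f + 0 * g" "g = 0 * f + 1 * g" by simp_all
    then have fgI: "f \<in> I" "g \<in> I" unfolding I_def using poly.one poly.zero by blast+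
    define d where "d = (ARG_MIN degree d. d \<in> I \<and> d \<noteq> 0)"
    have d: "d \<in> I" "d \<noteq> 0" and dmin: "\<And>x. x \<in> I \<Longrightarrow> x \<noteq> 0 \<Longrightarrow> degree d \<le> degree x"
      using arg_min_natI[of "\<lambda>d. d \<in> I \<and> d \<noteq> 0" f degree]
        arg_min_nat_le[of "\<lambda>d. d \<in> I \<and> d \<noteq> 0" _ degree] fgI f(2) unfolding d_def by auto
    have IA: "I \<subseteq> polys A" unfolding I_def using f gh by (auto intro!: poly.add poly.mult)
    have I_comb: "w * x - d * q \<in> I" if x: "x \<in> I" and wq: "w \<in> polys A" "q \<in> polys A" for x w q
    proof -
      obtain u v u' v' where *: "x = u * f + v * g" "d = u' * f + v' * g"
        "u \<in> polys A" "v \<in> polys A" "u' \<in> polys A" "v' \<in> polys A"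
        using x d unfolding I_def by blast
      have "w * x - d * q = (w * u - u' * q) * f + (w * v - v' * q) * g"
        by (simp add: * algebra_simps)
      then show ?thesis unfolding I_def using * wq by (blast intro: poly.diff poly.mult)
    qed
    \<comment> \<open>Remainders of pseudo-division by \<open>d\<close> stay in the ideal, so the
      minimal degree of \<open>d\<close> makes them vanish.\<close>
    have ex: "\<exists>c\<in>A. \<exists>q\<in>polys A. c \<noteq> 0 \<and> [:c:] * x = d * q" if x: "x \<in> I" for x
    proof -
      obtain c q r where cqr: "c \<in> A" "q \<in> polys A" "r \<in> polys A" "c \<noteq> 0"
        "[:c:] * x = d * q + r" "r = 0 \<or> degree r < degree d"
        using pseudo_division[of d x] d IA x by blast
      then have "r = [:c:] * x - d * q" by simp
      then have "r \<in> I" using I_comb[OF x, of "[:c:]" q] cqr by simp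
      then have "r = 0" using cqr(6) dmin by (meson leD)
      then show ?thesis using cqr by auto
    qed
    obtain c q where cq: "c \<in> A" "q \<in> polys A" "c \<noteq> 0" "[:c:] * f = d * q" using ex[OF fgI(1)] by blast
    obtain c' q' where cq': "c' \<in> A" "q' \<in> polys A" "c' \<noteq> 0" "[:c':] * g = d * q'"
      using ex[OF fgI(2)] by blast
    obtain c1 c2 d' e' where *: "c1 \<in> A" "c2 \<in> A" "d' \<in> polys A" "e' \<in> polys A"
        "d = [:c1:] * d'" "q = [:c2:] * e'" "d' * e' = f"
      using split_const_factor[OF cq(1,3) _ cq(2) f(1) cq(4)[symmetric]] d IA by blast
    consider "degree e' = 0" | "degree d' = 0" using f_fact * by metis
    then show ?thesis
    proof cases
      case 1
      then obtain a where a: "a \<in> A" "e' = [:a:]" using degree_0_polys * by blast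
      then have "a \<noteq> 0" using * f by auto
      have "[:a * c':] = [:a:] * [:c':]" by simp
      then have "[:a * c':] * g = [:a:] * ([:c1:] * d' * q')" using cq'(4) *(5)
        by (simp only: mult.assoc)
      also have "\<dots> = f * ([:c1:] * q')" by (simp only: *(7)[symmetric] a(2) mult_ac)
      finally have "[:a * c':] * g = f * ([:c1:] * q')" .
      moreover have "a * c' \<noteq> 0" using no_zero_divisors a cq' \<open>a \<noteq> 0\<close> by blast
      ultimately have "dvd_on (polys A) f g"
        using f(1) gh(1) mult[OF a(1) cq'(1)] poly.mult[OF _ cq'(2), of "[:c1:]"] *(1)
        by (intro dvd_on_cancel_const[of "a * c'" f g "[:c1:] * q'", OF _ _ _ _ _ _ primitive])
          (simp_all only: const_polys not_False_eq_True)
      then show ?thesis by simp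
    next
      \<comment> \<open>Here \<open>d\<close> is a constant \<open>k\<close> and a combination of
        \<open>f\<close> and \<open>g\<close>; multiplying that combination by \<open>h\<close>
        makes \<open>k * h\<close> a multiple of \<open>f\<close>.\<close>
      case 2
      then obtain b where b: "b \<in> A" "d' = [:b:]" using degree_0_polys * by blast
      define k where "k = c1 * b"
      have k: "k \<in> A" "d = [:k:]" using *(5) b mult[OF *(1) b(1)] by (simp_all add: k_def mult.commute)
      have k0: "k \<noteq> 0" using d(2) k(2) by simp
      obtain u v where uv: "u \<in> polys A" "v \<in> polys A" "d = u * f + v * g" using d I_def by blast
      obtain w where w: "w \<in> polys A" "g * h = f * w" using gh by (auto simp: dvd_on_def)
      have "[:k:] * h = (u * f + v * g) * h" by (simp only: k(2)[symmetric] uv(3))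
      also have "\<dots> = u * f * h + v * (g * h)" by (simp add: algebra_simps)
      also have "\<dots> = f * (u * h + v * w)" using w by (simp add: algebra_simps)
      finally have "[:k:] * h = f * (u * h + v * w)" .
      moreover have "u * h + v * w \<in> polys A" using uv w gh by (intro poly.add poly.mult)
      ultimately show ?thesis using dvd_on_cancel_const[of k f h "u * h + v * w"] primitive k k0 f gh by blast
    qed
  qed
  then show ?thesis using f by (simp add: prime_on_def)
qed

lemma factorial_subdomain_polys:
  "factorial_subdomain (polys A) (\<lambda>p. \<delta> (lead_coeff p) + degree p)"
proof
  fix p q assume "p \<in> polys A" "q \<in> polys A" "p \<noteq> 0" "q \<noteq> 0"
  then show "\<delta> (lead_coeff (p * q)) + degree (p * q) =
      \<delta> (lead_coeff p) + degree p + (\<delta> (lead_coeff q) + degree q)"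
    using length_mult[of "lead_coeff p" "lead_coeff q"] degree_mult_polys[of p q]
    by (simp add: polys_def)
next
  fix p assume p: "p \<in> polys A" "p \<noteq> 0" "\<delta> (lead_coeff p) + degree p = 0"
  then obtain a where "a \<in> A" "p = [:a:]" using degree_0_polys by auto
  then show "unit_on (polys A) p" using length_zero[of a] p by (auto simp: unit_on_polys)
qed (rule irreducible_polys_prime)

end

text \<open>Needed because \<open>polys\<close> leaves the type of its coefficients: an evaluation
  map carries univariate polynomials back to multivariate ones, and the length is transported along
  its inverse.\<close>

lemma factorial_subdomain_image:
  fixes h :: "'a::comm_ring_1 \<Rightarrow> 'b::comm_ring_1"
  assumes "factorial_subdomain B \<delta>"
    and inj: "inj_on h B" and h1: "h 1 = 1"
    and hd: "\<And>a b. h (a - b) = h a - h b" and hm: "\<And>a b. h (a * b) = h a * h b"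
  shows "factorial_subdomain (h ` B) (\<lambda>b. \<delta> (inv_into B h b))"
proof -
  interpret factorial_subdomain B \<delta> by fact
  have h0: "h 0 = 0" using hd[of 0 0] by simp
  have h0': "a = 0" if "h a = 0" "a \<in> B" for a using inj_onD[OF inj, of a 0] that h0 zero by simp
  have dvd: "dvd_on (h ` B) (h a) (h b) \<longleftrightarrow> dvd_on B a b" if "a \<in> B" "b \<in> B" for a b
  proof
    assume "dvd_on (h ` B) (h a) (h b)"
    then obtain c where c: "c \<in> B" "h b = h (a * c)" using hm by (auto simp: dvd_on_def)
    then have "b = a * c" using inj_onD[OF inj c(2) that(2) mult[OF that(1) c(1)]] by blast
    then show "dvd_on B a b" using c(1) by (auto simp: dvd_on_def)
  next
    assume "dvd_on B a b"
    then show "dvd_on (h ` B) (h a) (h b)" using hm by (auto simp: dvd_on_def)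
  qed
  have unit: "unit_on (h ` B) (h a) \<longleftrightarrow> unit_on B a" if "a \<in> B" for a
    using that dvd[OF that one] h1 by (simp add: unit_on_def)
  show ?thesis
  proof
    show "1 \<in> h ` B" using one h1 by (metis image_eqI)
    show "a - b \<in> h ` B" if "a \<in> h ` B" "b \<in> h ` B" for a b
      using that diff hd by (metis (no_types, lifting) imageE imageI)
    show "a * b \<in> h ` B" if "a \<in> h ` B" "b \<in> h ` B" for a b
      using that mult hm by (metis (no_types, lifting) imageE imageI)
    show "a = 0 \<or> b = 0" if "a \<in> h ` B" "b \<in> h ` B" "a * b = 0" for a b
    proof -
      from that obtain x y where xy: "x \<in> B" "y \<in> B" "a = h x" "b = h y" by blast
      then have "x * y = 0" using that(3) h0'[of "x * y"] mult by (simp add: hm)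
      then show ?thesis using no_zero_divisors xy h0 by blast
    qed
    show "\<delta> (inv_into B h (a * b)) = \<delta> (inv_into B h a) + \<delta> (inv_into B h b)"
      if "a \<in> h ` B" "b \<in> h ` B" "a \<noteq> 0" "b \<noteq> 0" for a b
    proof -
      from that obtain x y where xy: "x \<in> B" "y \<in> B" "a = h x" "b = h y" "x \<noteq> 0" "y \<noteq> 0"
        using h0 by blast
      then have "inv_into B h (a * b) = x * y" using inj mult hm by (metis inv_into_f_f)
      then show ?thesis using xy length_mult[of x y] inj by simp
    qed
    show "unit_on (h ` B) a" if "a \<in> h ` B" "a \<noteq> 0" "\<delta> (inv_into B h a) = 0" for a
    proof -
      from that obtain x where x: "x \<in> B" "a = h x" "x \<noteq> 0" using h0 by blast
      then have "\<delta> x = 0" using that inj by simp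
      then show ?thesis using x length_zero unit by blast
    qed
    show "prime_on (h ` B) a" if a: "irreducible_on (h ` B) a" for a
    proof -
      obtain x where x: "x \<in> B" "a = h x" using a by (auto simp: irreducible_on_def)
      have "irreducible_on B x"
        unfolding irreducible_on_def
      proof (intro conjI ballI impI)
        show "x \<in> B" "x \<noteq> 0" "\<not> unit_on B x" using a x h0 unit by (auto simp: irreducible_on_def)
        fix y z assume "y \<in> B" "z \<in> B" "x = y * z"
        then show "unit_on B y \<or> unit_on B z"
          using a x unit hm unfolding irreducible_on_def by blast
      qed
      then have prime: "prime_on B x" by (rule irreducible_prime)
      show ?thesis
        unfolding prime_on_def
      proof (intro conjI ballI impI)
        show "a \<in> h ` B" "a \<noteq> 0" "\<not> unit_on (h ` B) a" using a by (auto simp: irreducible_on_def)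
        fix b c assume "b \<in> h ` B" "c \<in> h ` B" and bc: "dvd_on (h ` B) a (b * c)"
        then obtain y z where yz: "y \<in> B" "z \<in> B" "b = h y" "c = h z" by blast
        then have "dvd_on (h ` B) (h x) (h (y * z))" using bc x hm by simp
        then have "dvd_on B x (y * z)" using dvd x(1) mult[OF yz(1,2)] by blast
        then have "dvd_on B x y \<or> dvd_on B x z" using prime yz unfolding prime_on_def by blast
        then show "dvd_on (h ` B) a b \<or> dvd_on (h ` B) a c" using x yz dvd by simp
      qed
    qed
  qed
qed

section \<open>Multivariate polynomials\<close>

abbreviation "lookup \<equiv> Poly_Mapping.lookup"
abbreviation "keys \<equiv> Poly_Mapping.keys"
abbreviation "single \<equiv> Poly_Mapping.single"

lemma poly_mapping_sum_single: "p = (\<Sum>m\<in>keys p. single m (lookup p m))"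
proof (rule poly_mapping_eqI)
  fix k
  show "lookup p k = lookup (\<Sum>m\<in>keys p. single m (lookup p m)) k"
    by (cases "k \<in> keys p") (auto simp: lookup_sum lookup_single when_def in_keys_iff)
qed

lemma mult_single_sum:
  fixes p :: "'a::comm_monoid_add \<Rightarrow>\<^sub>0 'b::comm_semiring_1"
  shows "p * single k c = (\<Sum>m\<in>keys p. single (m + k) (lookup p m * c))"
  using arg_cong[OF poly_mapping_sum_single[of p], of "\<lambda>r. r * single k c"]
  by (simp add: sum_distrib_right mult_single)

lemma mult_sum_single:
  fixes p q :: "'a::comm_monoid_add \<Rightarrow>\<^sub>0 'b::comm_semiring_1"
  shows "p * q = (\<Sum>a\<in>keys p. \<Sum>b\<in>keys q. single (a + b) (lookup p a * lookup q b))"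
  using arg_cong2[OF poly_mapping_sum_single[of p] poly_mapping_sum_single[of q], of "(*)"]
  by (simp add: sum_product mult_single)

lemma lookup_mult_const:
  fixes p :: "'a::comm_monoid_add \<Rightarrow>\<^sub>0 'b::comm_semiring_1"
  shows "lookup (p * single 0 c) m = lookup p m * c"
  by (auto simp: mult_single_sum lookup_sum lookup_single when_def in_keys_iff)

definition vars_in :: "'n set \<Rightarrow> (('n \<Rightarrow>\<^sub>0 nat) \<Rightarrow>\<^sub>0 'a::zero) set" where
  "vars_in S = {p. \<forall>m\<in>keys p. keys m \<subseteq> S}"

lemma keys_add_nat: "keys (a + b) = keys a \<union> keys (b :: 'n \<Rightarrow>\<^sub>0 nat)"
  by (auto simp: in_keys_iff lookup_add)

lemma vars_in_single: "keys m \<subseteq> S \<Longrightarrow> single m c \<in> vars_in S"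
  by (simp add: vars_in_def)

lemma vars_in_add: "p \<in> vars_in S \<Longrightarrow> q \<in> vars_in S \<Longrightarrow> p + q \<in> vars_in S"
  using keys_add[of p q] by (auto simp: vars_in_def)

lemma vars_in_sum:
  "(\<And>i. i \<in> I \<Longrightarrow> p i \<in> vars_in S) \<Longrightarrow> (\<Sum>i\<in>I. p i) \<in> vars_in S"
  by (induction I rule: infinite_finite_induct) (simp_all add: vars_in_add, simp_all add: vars_in_def)

lemma vars_in_mult:
  fixes p q :: "('n \<Rightarrow>\<^sub>0 nat) \<Rightarrow>\<^sub>0 'a::comm_semiring_1"
  shows "p \<in> vars_in S \<Longrightarrow> q \<in> vars_in S \<Longrightarrow> p * q \<in> vars_in S"
  unfolding mult_sum_single by (intro vars_in_sum vars_in_single) (auto simp: vars_in_def keys_add_nat)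

lemma vars_in_mono: "S \<subseteq> T \<Longrightarrow> vars_in S \<subseteq> vars_in T"
  by (auto simp: vars_in_def)

section \<open>Unique factorisation by induction on the set of variables\<close>

lemma factorial_subdomain_consts:
  "factorial_subdomain (vars_in {} :: (('n \<Rightarrow>\<^sub>0 nat) \<Rightarrow>\<^sub>0 'a::field) set) (\<lambda>_. 0)"
proof -
  have vars_in_empty: "p \<in> vars_in {} \<longleftrightarrow> (\<exists>c. p = single 0 c)" for p :: "('n \<Rightarrow>\<^sub>0 nat) \<Rightarrow>\<^sub>0 'a"
  proof
    assume p: "p \<in> vars_in {}"
    have "keys m = {} \<Longrightarrow> m = 0" for m :: "'n \<Rightarrow>\<^sub>0 nat"
      by (intro poly_mapping_eqI) (auto simp: in_keys_iff set_eq_iff)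
    then have "keys p \<subseteq> {0}" using p by (auto simp: vars_in_def)
    then have "p = single 0 (lookup p 0)"
      by (intro poly_mapping_eqI) (auto simp: lookup_single when_def in_keys_iff)
    then show "\<exists>c. p = single 0 c" by blast
  qed (auto simp: vars_in_def split: if_splits)
  have unit: "unit_on (vars_in {}) p" if p: "p \<in> vars_in {}" "p \<noteq> 0"
    for p :: "('n \<Rightarrow>\<^sub>0 nat) \<Rightarrow>\<^sub>0 'a"
  proof -
    obtain c where c: "p = single 0 c" using p(1) unfolding vars_in_empty by blast
    then have "c \<noteq> 0" using p(2) by auto
    then have "1 = p * single 0 (inverse c)" using c by (simp add: mult_single)
    moreover have "single 0 (inverse c) \<in> vars_in {}" by (rule vars_in_single) simp
    ultimately show ?thesis using p(1) unfolding unit_on_def dvd_on_def by (intro conjI bexI)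
  qed
  show ?thesis
  proof
    show "1 \<in> vars_in {}" by (simp add: vars_in_def)
    show "a - b \<in> vars_in {}" if "a \<in> vars_in {}" "b \<in> vars_in {}" for a b :: "('n \<Rightarrow>\<^sub>0 nat) \<Rightarrow>\<^sub>0 'a"
      using that unfolding vars_in_empty by (auto simp: single_diff[symmetric])
    show "a = 0 \<or> b = 0" if ab: "a \<in> vars_in {}" "b \<in> vars_in {}" "a * b = 0"
      for a b :: "('n \<Rightarrow>\<^sub>0 nat) \<Rightarrow>\<^sub>0 'a"
    proof -
      obtain c d where cd: "a = single 0 c" "b = single 0 d" using ab(1,2) unfolding vars_in_empty by blast
      then have "lookup (a * b) 0 = c * d" by (simp add: mult_single)
      then show ?thesis using ab(3) cd by auto
    qed
    show "prime_on (vars_in {}) a" if "irreducible_on (vars_in {}) a" for a :: "('n \<Rightarrow>\<^sub>0 nat) \<Rightarrow>\<^sub>0 'a"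
    proof -
      have "unit_on (vars_in {}) a" using that by (intro unit) (simp_all add: irreducible_on_def)
      then show ?thesis using that by (simp add: irreducible_on_def)
    qed
  qed (use unit in \<open>simp_all add: vars_in_mult\<close>)
qed

lemma factorial_subdomain_insert:
  assumes "factorial_subdomain (vars_in S :: (('n \<Rightarrow>\<^sub>0 nat) \<Rightarrow>\<^sub>0 'a::field) set) \<delta>" and y: "y \<notin> S"
  shows "\<exists>\<delta>. factorial_subdomain (vars_in (insert y S) :: (('n \<Rightarrow>\<^sub>0 nat) \<Rightarrow>\<^sub>0 'a) set) \<delta>"
proof -
  interpret factorial_subdomain "vars_in S :: (('n \<Rightarrow>\<^sub>0 nat) \<Rightarrow>\<^sub>0 'a) set" \<delta> by fact
  define Y :: "('n \<Rightarrow>\<^sub>0 nat) \<Rightarrow>\<^sub>0 'a" where "Y = single (single y 1) 1"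
  have Y: "Y ^ j = single (single y j) 1" for j
    by (induction j) (simp_all add: Y_def mult_single single_add[symmetric])
  define h where "h = (\<lambda>P. poly P Y)"
  \<comment> \<open>An exponent splits uniquely into a part without \<open>y\<close> and a power of
    \<open>y\<close>, so the coefficients of \<open>P\<close> can be read off from
    \<open>h P\<close>; this makes \<open>h\<close> injective.\<close>
  have lookup_h: "lookup (h P) (m + single y i) = lookup (coeff P i) m"
    if P: "P \<in> polys (vars_in S)" and m: "y \<notin> keys m" for P m i
  proof -
    have eq: "a + single y j = m + single y i \<longleftrightarrow> a = m \<and> j = i" if "a \<in> keys (coeff P j)" for a j
    proof
      assume *: "a + single y j = m + single y i"
      have "y \<notin> keys a" using P y that by (auto simp: polys_def vars_in_def)
      then have "lookup a y = 0" "lookup m y = 0" using m by (simp_all add: in_keys_iff)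
      then have "j = i" using arg_cong[OF *, of "\<lambda>k. lookup k y"] by (simp add: lookup_add)
      then show "a = m \<and> j = i" using * by simp
    qed simp
    have "h P = (\<Sum>j\<le>degree P. \<Sum>a\<in>keys (coeff P j). single (a + single y j) (lookup (coeff P j) a))"
      by (simp add: h_def poly_altdef Y mult_single_sum)
    then have "lookup (h P) (m + single y i) = (\<Sum>j\<le>degree P. \<Sum>a\<in>keys (coeff P j).
        (lookup (coeff P j) a when a + single y j = m + single y i))"
      by (simp add: lookup_sum lookup_single)
    also have "\<dots> = (\<Sum>j\<le>degree P. \<Sum>a\<in>keys (coeff P j).
        (if a = m then (if j = i then lookup (coeff P j) a else 0) else 0))"
      by (intro sum.cong refl) (auto simp: eq when_def)
    also have "\<dots> = (\<Sum>j\<le>degree P. if j = i then lookup (coeff P j) m else 0)"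
      by (intro sum.cong refl) (auto simp: in_keys_iff)
    also have "\<dots> = lookup (coeff P i) m"
      by (auto simp: coeff_eq_0)
    finally show ?thesis .
  qed
  have inj: "inj_on h (polys (vars_in S))"
  proof (rule inj_onI)
    fix P Q assume PQ: "P \<in> polys (vars_in S)" "Q \<in> polys (vars_in S)" "h P = h Q"
    show "P = Q"
    proof (intro poly_eqI poly_mapping_eqI)
      fix i m
      show "lookup (coeff P i) m = lookup (coeff Q i) m"
      proof (cases "y \<in> keys m")
        case True
        then have "m \<notin> keys (coeff P i)" "m \<notin> keys (coeff Q i)"
          using PQ(1,2) y unfolding polys_def vars_in_def by blast+
        then show ?thesis by (simp add: in_keys_iff)
      next
        case False
        then show ?thesis using lookup_h PQ by metis
      qed
    qed
  qed
  have image: "h ` polys (vars_in S) = vars_in (insert y S)"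
  proof (intro equalityI subsetI)
    fix p assume "p \<in> h ` polys (vars_in S)"
    then obtain P where P: "P \<in> polys (vars_in S)" "p = h P" by blast
    have "coeff P i \<in> vars_in (insert y S)" for i
      using P(1) vars_in_mono[of S "insert y S"] by (auto simp: polys_def)
    moreover have "Y ^ i \<in> vars_in (insert y S)" for i
      unfolding Y by (intro vars_in_single) simp
    ultimately show "p \<in> vars_in (insert y S)"
      unfolding P(2) h_def poly_altdef by (intro vars_in_sum vars_in_mult)
  next
    fix p :: "('n \<Rightarrow>\<^sub>0 nat) \<Rightarrow>\<^sub>0 'a" assume p: "p \<in> vars_in (insert y S)"
    \<comment> \<open>\<open>r\<close> deletes \<open>y\<close> from an exponent; collecting the
      terms of \<open>p\<close> by powers of \<open>y\<close> then gives a preimage under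
      \<open>h\<close>.\<close>
    define r where "r = (\<lambda>m :: 'n \<Rightarrow>\<^sub>0 nat. Poly_Mapping.update y 0 m)"
    have r: "r m + single y (lookup m y) = m" for m
      by (intro poly_mapping_eqI) (auto simp: r_def lookup_add lookup_update lookup_single when_def)
    define P where "P = (\<Sum>m\<in>keys p. monom (single (r m) (lookup p m)) (lookup m y))"
    have "h P = (\<Sum>m\<in>keys p. single (r m) (lookup p m) * Y ^ lookup m y)"
      by (simp add: h_def P_def poly_sum poly_monom)
    also have "\<dots> = p"
      by (simp add: Y mult_single r poly_mapping_sum_single[of p, symmetric])
    finally have "p = h P" by simp
    moreover have "P \<in> polys (vars_in S)"
      unfolding P_def using p
      by (intro subdomain.sum[OF subdomain_polys] monom_polys vars_in_single)
        (auto simp: vars_in_def r_def keys_update split: if_splits)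
    ultimately show "p \<in> h ` polys (vars_in S)" by blast
  qed
  show ?thesis
    using factorial_subdomain_image[OF factorial_subdomain_polys inj] unfolding image
    by (intro exI) (simp add: h_def)
qed

lemma factorial_subdomain_mpoly:
  "\<exists>\<delta>. factorial_subdomain (UNIV :: (('n::finite \<Rightarrow>\<^sub>0 nat) \<Rightarrow>\<^sub>0 'a::field) set) \<delta>"
proof -
  have "\<exists>\<delta>. factorial_subdomain (vars_in S :: (('n \<Rightarrow>\<^sub>0 nat) \<Rightarrow>\<^sub>0 'a) set) \<delta>" for S :: "'n set"
    using finite[of S]
  proof (induction S rule: finite_induct)
    case empty
    show ?case by (rule exI[of _ "\<lambda>_. 0"]) (rule factorial_subdomain_consts)
  next
    case (insert y S)
    then obtain \<delta> where "factorial_subdomain (vars_in S :: (('n \<Rightarrow>\<^sub>0 nat) \<Rightarrow>\<^sub>0 'a) set) \<delta>" by blast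
    then show ?case by (rule factorial_subdomain_insert) (rule insert.hyps)
  qed
  from this[of UNIV] show ?thesis by (simp add: vars_in_def)
qed

lemma mpoly_mult_eq_0:
  fixes p q :: "('n::finite \<Rightarrow>\<^sub>0 nat) \<Rightarrow>\<^sub>0 'a::field"
  assumes "p * q = 0"
  shows "p = 0 \<or> q = 0"
proof -
  obtain \<delta> where "factorial_subdomain (UNIV :: (('n \<Rightarrow>\<^sub>0 nat) \<Rightarrow>\<^sub>0 'a) set) \<delta>"
    using factorial_subdomain_mpoly by blast
  then interpret UNIV: factorial_subdomain "UNIV :: (('n \<Rightarrow>\<^sub>0 nat) \<Rightarrow>\<^sub>0 'a) set" \<delta> .
  show ?thesis using UNIV.no_zero_divisors[OF _ _ assms] by simp
qed

lemma mpoly_irreducible_dvd_mult: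
  fixes p q r :: "('n::finite \<Rightarrow>\<^sub>0 nat) \<Rightarrow>\<^sub>0 'a::field"
  assumes "irreducible p" "p dvd q * r"
  shows "p dvd q \<or> p dvd r"
proof -
  obtain \<delta> where "factorial_subdomain (UNIV :: (('n \<Rightarrow>\<^sub>0 nat) \<Rightarrow>\<^sub>0 'a) set) \<delta>"
    using factorial_subdomain_mpoly by blast
  then interpret UNIV: factorial_subdomain "UNIV :: (('n \<Rightarrow>\<^sub>0 nat) \<Rightarrow>\<^sub>0 'a) set" \<delta> .
  have dvd: "dvd_on UNIV a b \<longleftrightarrow> a dvd b" for a b :: "('n \<Rightarrow>\<^sub>0 nat) \<Rightarrow>\<^sub>0 'a"
    by (auto simp: dvd_on_def dvd_def)
  have "irreducible_on UNIV p"
    using assms(1) by (simp add: irreducible_on_def irreducible_def unit_on_def dvd)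
  then have "prime_on UNIV p" by (rule UNIV.irreducible_prime)
  then show ?thesis using assms(2) by (simp add: prime_on_def dvd)
qed

section \<open>Total degree and sign substitutions\<close>

definition mdeg :: "('n::finite \<Rightarrow>\<^sub>0 nat) \<Rightarrow> nat" where
  "mdeg m = (\<Sum>i\<in>UNIV. lookup m i)"

lemma mdeg_add: "mdeg (a + b) = mdeg a + mdeg b"
  by (simp add: mdeg_def lookup_add sum.distrib)

lemma mdeg_le_total_degree: "m \<in> keys p \<Longrightarrow> mdeg m \<le> total_degree p"
  unfolding total_degree_def mdeg_def by (intro Max_ge) auto

lemma total_degree_le: "(\<And>m. m \<in> keys p \<Longrightarrow> mdeg m \<le> d) \<Longrightarrow> total_degree p \<le> d"
  unfolding total_degree_def mdeg_def by auto

lemma total_degree_attained: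
  assumes "p \<noteq> 0"
  shows "\<exists>m\<in>keys p. mdeg m = total_degree p"
proof -
  have ne: "keys p \<noteq> {}" using assms poly_mapping_sum_single[of p] by auto
  have "total_degree p \<in> insert 0 (mdeg ` keys p)"
    unfolding total_degree_def mdeg_def[abs_def] by (intro Max_in) auto
  then show ?thesis using ne mdeg_le_total_degree[of _ p] by fastforce
qed

definition leading_form :: "'n::finite mpoly \<Rightarrow> 'n mpoly" where
  "leading_form p = (\<Sum>m | m \<in> keys p \<and> mdeg m = total_degree p. single m (lookup p m))"

lemma lookup_leading_form:
  "lookup (leading_form p) m = (lookup p m when mdeg m = total_degree p)"
  unfolding leading_form_def
  by (auto simp: lookup_sum lookup_single when_def in_keys_iff)

text \<open>For the lower bound, the product of the leading forms is nonzero as there are no zero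
  divisors, and all remaining products of terms have smaller degree, so a monomial \<open>k\<close>
  of it survives.\<close>

lemma total_degree_mult:
  fixes p q :: "'n::finite mpoly"
  assumes "p \<noteq> 0" "q \<noteq> 0"
  shows "total_degree (p * q) = total_degree p + total_degree q"
proof (rule antisym)
  show "total_degree (p * q) \<le> total_degree p + total_degree q"
  proof (rule total_degree_le)
    fix m assume "m \<in> keys (p * q)"
    then obtain a b where "m = a + b" "a \<in> keys p" "b \<in> keys q" using keys_mult[of p q] by blast
    then show "mdeg m \<le> total_degree p + total_degree q"
      using mdeg_le_total_degree[of a p] mdeg_le_total_degree[of b q] by (simp add: mdeg_add)
  qed
next
  have lf: "leading_form r \<noteq> 0" if "r \<noteq> 0" for r :: "'n mpoly"
  proof -
    obtain m where m: "m \<in> keys r" "mdeg m = total_degree r" using total_degree_attained \<open>r \<noteq> 0\<close> by blast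
    then have "lookup (leading_form r) m \<noteq> 0" by (simp add: lookup_leading_form in_keys_iff)
    then show ?thesis by auto
  qed
  have keys_lf: "mdeg m = total_degree r" if "m \<in> keys (leading_form r)" for m and r :: "'n mpoly"
    using that by (auto simp: in_keys_iff lookup_leading_form when_def split: if_splits)
  define p' where "p' = p - leading_form p"
  define q' where "q' = q - leading_form q"
  have low: "mdeg m < total_degree r" if "m \<in> keys (r - leading_form r)" for m and r :: "'n mpoly"
  proof -
    have "lookup r m \<noteq> 0 \<and> mdeg m \<noteq> total_degree r"
      using that by (auto simp: in_keys_iff lookup_minus lookup_leading_form when_def split: if_splits)
    then show ?thesis using mdeg_le_total_degree[of m r] by (simp add: in_keys_iff)
  qed
  have "leading_form p * leading_form q \<noteq> 0" using mpoly_mult_eq_0 lf assms by blast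
  then obtain k where k: "lookup (leading_form p * leading_form q) k \<noteq> 0"
    using poly_mapping_eqI[of "leading_form p * leading_form q" 0] by auto
  then obtain a b where "k = a + b" "a \<in> keys (leading_form p)" "b \<in> keys (leading_form q)"
    using keys_mult[of "leading_form p" "leading_form q"] unfolding in_keys_iff[symmetric] by blast
  then have degk: "mdeg k = total_degree p + total_degree q" using keys_lf by (simp add: mdeg_add)
  have 1: "k \<notin> keys (leading_form p * q')"
  proof
    assume "k \<in> keys (leading_form p * q')"
    then obtain a b where "k = a + b" "a \<in> keys (leading_form p)" "b \<in> keys q'"
      using keys_mult by blast
    then show False using degk keys_lf[of a p] low[of b q] by (simp add: mdeg_add q'_def)
  qed
  have 2: "k \<notin> keys (p' * q)"
  proof
    assume "k \<in> keys (p' * q)"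
    then obtain a b where "k = a + b" "a \<in> keys p'" "b \<in> keys q" using keys_mult by blast
    then show False using degk low[of a p] mdeg_le_total_degree[of b q] by (simp add: mdeg_add p'_def)
  qed
  have "p * q = leading_form p * leading_form q + leading_form p * q' + p' * q"
    by (simp add: p'_def q'_def algebra_simps)
  then have "lookup (p * q) k = lookup (leading_form p * leading_form q) k"
    using 1 2 by (simp add: lookup_add in_keys_iff)
  then have "k \<in> keys (p * q)" using k by (simp add: in_keys_iff)
  then show "total_degree p + total_degree q \<le> total_degree (p * q)"
    using mdeg_le_total_degree degk by metis
qed

lemma total_degree_0_const:
  fixes p :: "'n::finite mpoly"
  assumes "total_degree p = 0"
  shows "p = single 0 (lookup p 0)"
proof -
  have "m = 0" if "m \<in> keys p" for m
    using mdeg_le_total_degree[OF that] assms by (intro poly_mapping_eqI) (simp add: mdeg_def)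
  then show ?thesis by (intro poly_mapping_eqI) (auto simp: lookup_single when_def in_keys_iff)
qed

text \<open>Comparing degrees, the cofactor is a constant. The proofs of non-divisibility below pass
  from \<open>dvd\<close> to proportional coefficients through this.\<close>

lemma dvd_total_degree_le:
  fixes p q :: "'n::finite mpoly"
  assumes "p dvd q" "q \<noteq> 0" "total_degree q \<le> total_degree p"
  shows "\<exists>k. k \<noteq> 0 \<and> (\<forall>m. lookup q m = k * lookup p m)"
proof -
  obtain r where r: "q = p * r" using assms(1) by blast
  then have nz: "p \<noteq> 0" "r \<noteq> 0" using assms(2) by auto
  then have "total_degree r = 0" using total_degree_mult[of p r] assms(3) r by simp
  then obtain k where k: "r = single 0 k" using total_degree_0_const by blast
  then have "k \<noteq> 0" using nz by auto
  then show ?thesis using r k lookup_mult_const[of p k] by (auto simp: mult.commute)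
qed

lift_definition scale_coeffs :: "('a \<Rightarrow> 'b) \<Rightarrow> ('a \<Rightarrow>\<^sub>0 'b) \<Rightarrow> ('a \<Rightarrow>\<^sub>0 'b::comm_semiring_1)"
  is "\<lambda>c p m. c m * p m"
  by (rule finite_subset[rotated]) auto

lemma lookup_scale_coeffs [simp]: "lookup (scale_coeffs c p) m = c m * lookup p m"
  by transfer simp

lemma scale_coeffs_sum: "scale_coeffs c (sum p I) = (\<Sum>i\<in>I. scale_coeffs c (p i))"
  by (intro poly_mapping_eqI) (simp add: lookup_sum sum_distrib_left)

lemma scale_coeffs_single: "scale_coeffs c (single m a) = single m (c m * a)"
  by (intro poly_mapping_eqI) (simp add: lookup_single when_def)

text \<open>For multiplicative \<open>c\<close>, such as the values of monomials at a vector of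
  signs, the scaling is a substitution in the variables.\<close>

lemma scale_coeffs_mult:
  fixes p q :: "'a::comm_monoid_add \<Rightarrow>\<^sub>0 'b::comm_semiring_1"
  assumes "\<And>a b. c (a + b) = c a * c b"
  shows "scale_coeffs c (p * q) = scale_coeffs c p * scale_coeffs c q"
proof -
  have "scale_coeffs c (p * q) =
      (\<Sum>a\<in>keys p. \<Sum>b\<in>keys q. single a (c a * lookup p a) * single b (c b * lookup q b))"
    unfolding mult_sum_single[of p q]
    by (simp add: scale_coeffs_sum scale_coeffs_single assms mult_single mult_ac)
  also have "\<dots> = scale_coeffs c (\<Sum>a\<in>keys p. single a (lookup p a)) * scale_coeffs c (\<Sum>b\<in>keys q. single b (lookup q b))"
    by (simp add: scale_coeffs_sum scale_coeffs_single sum_product)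
  also have "\<dots> = scale_coeffs c p * scale_coeffs c q"
    by (simp only: poly_mapping_sum_single[symmetric])
  finally show ?thesis .
qed

section \<open>Conjugates of roots of unity\<close>

text \<open>Elements of the ring generated by a root of unity are represented by integer
  polynomials, so that conjugation is evaluation of the same polynomial at another root of
  unity.\<close>

definition ipoly :: "int poly \<Rightarrow> complex \<Rightarrow> complex" where
  "ipoly r z = poly (map_poly of_int r) z"

lemma ipoly_0 [simp]: "ipoly 0 z = 0"
  by (simp add: ipoly_def)

lemma ipoly_pCons [simp]: "ipoly (pCons a r) z = of_int a + z * ipoly r z"
  by (simp add: ipoly_def map_poly_pCons)

lemma ipoly_1 [simp]: "ipoly 1 z = 1"
  by (simp add: one_pCons)

lemma ipoly_add [simp]: "ipoly (r + s) z = ipoly r z + ipoly s z"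
  by (induction r s rule: poly_induct2) (simp_all add: algebra_simps)

lemma ipoly_smult [simp]: "ipoly (smult c r) z = of_int c * ipoly r z"
  by (induction r) (simp_all add: algebra_simps)

lemma ipoly_minus [simp]: "ipoly (- r) z = - ipoly r z"
  using ipoly_smult[of "-1" r z] by simp

lemma ipoly_diff [simp]: "ipoly (r - s) z = ipoly r z - ipoly s z"
  using ipoly_add[of r "- s" z] by simp

lemma ipoly_mult [simp]: "ipoly (r * s) z = ipoly r z * ipoly s z"
  by (induction r) (simp_all add: algebra_simps)

lemma ipoly_power [simp]: "ipoly (r ^ n) z = ipoly r z ^ n"
  by (induction n) simp_all

lemma ipoly_sum [simp]: "ipoly (sum r A) z = (\<Sum>a\<in>A. ipoly (r a) z)"
  by (induction A rule: infinite_finite_induct) simp_all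

lemma ipoly_monom [simp]: "ipoly (monom a n) z = of_int a * z ^ n"
  by (simp add: ipoly_def map_poly_monom poly_monom)

lemma ipoly_pcompose [simp]: "ipoly (pcompose r s) z = ipoly r (ipoly s z)"
  by (induction r) (simp_all add: pcompose_pCons)

text \<open>The error has an explicit cofactor in an arbitrary commutative ring, so that both
  integers and integer polynomials are covered.\<close>

lemma freshmans_dream_dvd:
  fixes u v :: "'a::comm_ring_1"
  assumes "prime p"
  shows "\<exists>t. (u + v) ^ p = u ^ p + v ^ p + of_nat p * t"
proof -
  have p: "p > 0" using assms prime_gt_0_nat by blast
  have "p dvd (p choose k)" if "k \<in> {1..<p}" for k
    using that p by (intro dvd_choose_prime assms) auto
  then have "\<forall>k\<in>{1..<p}. \<exists>q. p choose k = p * q" unfolding dvd_def by blast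
  then obtain q where q: "\<And>k. k \<in> {1..<p} \<Longrightarrow> p choose k = p * q k" by metis
  have "(u + v) ^ p = (\<Sum>k\<le>p. of_nat (p choose k) * u ^ k * v ^ (p - k))"
    by (rule binomial_ring)
  also have "{..p} = insert 0 (insert p {1..<p})" using p by auto
  also have "(\<Sum>k\<in>\<dots>. of_nat (p choose k) * u ^ k * v ^ (p - k)) =
      u ^ p + v ^ p + (\<Sum>k\<in>{1..<p}. of_nat (p choose k) * u ^ k * v ^ (p - k))"
    using p by (simp add: algebra_simps)
  also have "(\<Sum>k\<in>{1..<p}. of_nat (p choose k) * u ^ k * v ^ (p - k)) =
      of_nat p * (\<Sum>k\<in>{1..<p}. of_nat (q k) * u ^ k * v ^ (p - k))"
    unfolding sum_distrib_left by (intro sum.cong) (auto simp: q algebra_simps)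
  finally show ?thesis by blast
qed

lemma fermat_little_int:
  fixes a :: int
  assumes p: "prime p"
  shows "[a ^ p = a] (mod int p)"
proof -
  have nat: "[int n ^ p = int n] (mod int p)" for n
  proof (induction n)
    case 0
    then show ?case using prime_gt_0_nat[OF p] by (simp add: power_0_left)
  next
    case (Suc n)
    obtain t where "(int n + 1) ^ p = int n ^ p + 1 ^ p + of_nat p * t"
      using freshmans_dream_dvd[OF p] by blast
    then have "[(int n + 1) ^ p = int n ^ p + 1] (mod int p)" by (simp add: cong_def)
    also have "[int n ^ p + 1 = int n + 1] (mod int p)" using Suc by (rule cong_add) simp
    finally show ?case by (simp add: add.commute)
  qed
  have a: "[int (nat (a mod int p)) = a] (mod int p)"
    using prime_gt_0_nat[OF p] by (simp add: cong_def)
  have "[a ^ p = int (nat (a mod int p)) ^ p] (mod int p)" using cong_pow[OF a] by (rule cong_sym)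
  then show ?thesis using nat a cong_trans by blast
qed

text \<open>One polynomial \<open>s\<close> serves all \<open>z\<close>; hence
  \<open>ipoly r z = 0\<close> makes \<open>ipoly r (z ^ p)\<close> equal to \<open>p\<close> times
  an integer polynomial in \<open>z\<close>.\<close>

lemma ipoly_frobenius:
  assumes "prime p"
  shows "\<exists>s. \<forall>z. ipoly r (z ^ p) = ipoly r z ^ p + of_nat p * ipoly s z"
proof (induction r)
  case 0
  then show ?case using assms prime_gt_0_nat[of p] by (auto intro!: exI[of _ 0] simp: power_0_left)
next
  case (pCons a r)
  then obtain s where s: "\<And>z. ipoly r (z ^ p) = ipoly r z ^ p + of_nat p * ipoly s z" by blast
  obtain t where t: "([:a:] + [:0, 1:] * r) ^ p = [:a:] ^ p + ([:0, 1:] * r) ^ p + of_nat p * t"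
    using freshmans_dream_dvd[OF assms] by blast
  have "[a ^ p = a] (mod int p)" by (rule fermat_little_int[OF assms])
  then obtain b where b: "a ^ p = a + int p * b"
    by (metis cong_iff_lin mult.commute cong_sym)
  have p: "ipoly (of_nat p * t) z = of_nat p * ipoly t z" for z
    by (simp add: of_nat_poly)
  show ?case
  proof (intro exI allI)
    fix z
    have "ipoly (pCons a r) z ^ p = of_int (a ^ p) + z ^ p * ipoly r z ^ p + of_nat p * ipoly t z"
      using arg_cong[OF t, of "\<lambda>q. ipoly q z"] p by (simp add: power_mult_distrib)
    \<comment> \<open>The three error terms come from the tail \<open>r\<close>, from the binomial
      expansion and from Fermat's congruence for \<open>a\<close>.\<close>
    then show "ipoly (pCons a r) (z ^ p) = ipoly (pCons a r) z ^ p
        + of_nat p * ipoly (monom 1 p * s - t - [:b:]) z"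
      by (simp add: s b algebra_simps)
  qed
qed

text \<open>The conjugates of a root of unity are found without splitting \<open>X\<^sup>L - 1\<close> modulo \<open>p\<close>: writing it as
  \<open>f h\<close> with \<open>f\<close> the minimal polynomial of \<open>z\<close>, if \<open>f (z\<^sup>p) \<noteq> 0\<close> then \<open>h (z\<^sup>p) = 0\<close>, and
  differentiating at \<open>z\<^sup>p\<close> expresses \<open>L\<close> as a multiple of \<open>f (z\<^sup>p) \<equiv> f (z)\<^sup>p = 0 (mod p)\<close>.\<close>

lemma ipoly_conjugate_prime:
  assumes z: "z ^ L = 1" and L: "L > 0" and p: "prime p" "\<not> p dvd L" and r: "ipoly r z = 0"
  shows "ipoly r (z ^ p) = 0"
proof -
  define P where "P = (monom 1 L - 1 :: int poly)"
  have Pz: "ipoly P w = w ^ L - 1" for w by (simp add: P_def)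
  have lP: "coeff P L = 1" "degree P = L"
    using L by (auto simp: P_def degree_monom_eq degree_add_eq_left[of "- 1"] simp flip: add_uminus_conv_diff)
  define Q where "Q = (\<lambda>q. q \<noteq> 0 \<and> ipoly q z = 0)"
  have "Q P" using Pz z lP L by (auto simp: Q_def)
  then obtain f0 where f0: "Q f0" "\<And>q. Q q \<Longrightarrow> degree f0 \<le> degree q"
    by (metis ex_has_least_nat)
  \<comment> \<open>Primitivity makes \<open>f\<close> divide over the integers every integer
    polynomial vanishing at \<open>z\<close>, and not merely a constant multiple of it.\<close>
  define f where "f = primitive_part f0"
  have f: "Q f" "content f = 1" "degree f = degree f0"
    using f0 content_times_primitive_part[of f0] ipoly_smult[of "content f0" "primitive_part f0" z]
    unfolding Q_def f_def by auto
  have f_least: "q = 0" if "ipoly q z = 0" "degree q < degree f" for q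
    using that f f0(2)[of q] by (force simp: Q_def)
  have f_dvd: "\<exists>c q. c \<noteq> 0 \<and> smult c g = f * q" if gz: "ipoly g z = 0" for g
  proof -
    obtain a q where aq: "a \<noteq> 0" "smult a g = f * q + pseudo_mod g f"
      using pseudo_mod(1)[of f g] f by (auto simp: Q_def)
    have "ipoly (pseudo_mod g f) z = 0"
      using arg_cong[OF aq(2), of "\<lambda>q. ipoly q z"] gz f by (simp add: Q_def)
    then have "pseudo_mod g f = 0"
      using pseudo_mod(2)[of f g] f f_least by (auto simp: Q_def)
    then show ?thesis using aq by auto
  qed
  have f_dvd': "f dvd g" if gz: "ipoly g z = 0" for g
  proof -
    obtain c q where c: "c \<noteq> 0" "smult c g = f * q" using f_dvd[OF gz] by blast
    have "content q = \<bar>c\<bar> * content g"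
      using arg_cong[OF c(2), of content] f by (simp add: content_mult normalize_int_def)
    then have "[:c:] dvd q" by (simp add: const_poly_dvd_iff_dvd_content)
    then obtain q' where "q = [:c:] * q'" by (rule dvdE)
    then have "smult c g = smult c (f * q')" using c by simp
    then have "g = f * q'" using c(1) by (metis smult_cancel)
    then show ?thesis by simp
  qed
  obtain h where h: "P = f * h" using f_dvd'[of P] Pz z by auto
  \<comment> \<open>\<open>P\<close> is monic, so \<open>f\<close> has leading coefficient 1 or -1
    and pseudo-division by \<open>f\<close> is honest division up to sign.\<close>
  have "lead_coeff f * lead_coeff h = 1" using lP h by (metis lead_coeff_mult)
  then have lf: "lead_coeff f dvd 1" by (metis dvd_triv_left)
  have df: "degree f > 0"
  proof (rule ccontr)
    assume "\<not> degree f > 0"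
    then obtain c where "f = [:c:]" by (auto elim: degree_eq_zeroE)
    then show False using f by (auto simp: Q_def)
  qed
  have "ipoly f (z ^ p) = 0"
  proof (rule ccontr)
    assume nz: "ipoly f (z ^ p) \<noteq> 0"
    let ?w = "z ^ p"
    have wL: "?w ^ L = 1" by (metis z power_mult power_mult mult.commute power_one)
    have "ipoly P ?w = 0" using Pz wL by simp
    then have hw: "ipoly h ?w = 0" using h nz by simp
    have "pderiv P = smult (int L) (monom 1 (L - 1))"
      by (simp add: P_def pderiv_diff pderiv_monom smult_monom)
    moreover have "pderiv P = f * pderiv h + h * pderiv f" using h by (simp add: pderiv_mult)
    ultimately have "ipoly (smult (int L) (monom 1 (L - 1))) ?w = ipoly (f * pderiv h + h * pderiv f) ?w"
      by simp
    then have 1: "of_nat L * ?w ^ (L - 1) = ipoly f ?w * ipoly (pderiv h) ?w" using hw by simp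
    obtain s where s: "\<And>x. ipoly f (x ^ p) = ipoly f x ^ p + of_nat p * ipoly s x"
      using ipoly_frobenius[OF p(1)] by blast
    have fw: "ipoly f ?w = of_nat p * ipoly s z" using s[of z] f p(1) prime_gt_0_nat[of p]
      by (simp add: Q_def power_0_left)
    have "of_nat L * (?w ^ (L - 1) * ?w) = of_nat p * (ipoly s z * ipoly (pderiv h) ?w * ?w)"
      by (simp only: mult.assoc[symmetric] 1 fw)
    moreover have "?w ^ (L - 1) * ?w = 1" using wL L by (metis power_minus_mult)
    ultimately have 2: "of_nat L = of_nat p * (ipoly s z * ipoly (pderiv h) ?w * ?w)"
      by (simp only: mult_1_right)
    define t where "t = s * pcompose (pderiv h) (monom 1 p) * monom 1 p"
    have 3: "of_nat L = of_nat p * ipoly t z" using 2 by (simp add: t_def)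
    define t' where "t' = pseudo_mod t f"
    define a where "a = lead_coeff f ^ (Suc (degree t) - degree f)"
    obtain q where q: "pseudo_divmod t f = (q, t')"
      unfolding t'_def pseudo_mod_def by (metis prod.collapse)
    have aq: "smult a t = f * q + t'"
      using pseudo_divmod(1)[OF _ q] f unfolding a_def Q_def by blast
    have "a dvd 1" unfolding a_def using lf by (metis dvd_power_same power_one)
    then have a: "a * a = 1" by (auto simp: zdvd1_eq abs_if split: if_splits)
    have "ipoly (smult a t) z = ipoly t' z" using aq f by (simp add: Q_def)
    \<comment> \<open>The remainder \<open>t'\<close> has degree below that of \<open>f\<close>, so
      minimality turns the relation at \<open>z\<close> into an identity of polynomials, whose
      constant term gives \<open>p dvd L\<close>.\<close>
    then have "ipoly (smult (int p) t' - [:a * int L:]) z = 0" using 3 by simp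
    moreover have "degree (smult (int p) t' - [:a * int L:]) < degree f"
      using pseudo_mod(2)[of f t] f df unfolding t'_def
      by (intro degree_diff_less) (auto simp: Q_def)
    ultimately have "smult (int p) t' - [:a * int L:] = 0" by (rule f_least)
    then have "coeff (smult (int p) t' - [:a * int L:]) 0 = 0" by simp
    then have "int p * coeff t' 0 = a * int L" by simp
    then have "int p * (a * coeff t' 0) = int L" using a
      by (metis mult.assoc mult.left_commute mult_1)
    then show False using p(2) by (metis dvd_triv_left int_dvd_int_iff)
  qed
  moreover obtain q where "r = f * q" using f_dvd'[OF r] by blast
  ultimately show ?thesis by simp
qed

text \<open>The prime factors of \<open>j\<close> are used one at a time: \<open>z ^ k\<close> is
  again an \<open>L\<close>-th root of unity, and \<open>r\<close> already vanishes there.\<close>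

lemma ipoly_conjugate:
  assumes z: "z ^ L = 1" and L: "L > 0" and "j > 0" and j: "coprime j L" and r: "ipoly r z = 0"
  shows "ipoly r (z ^ j) = 0"
  using assms(3) j r
proof (induction j rule: less_induct)
  case (less j)
  show ?case
  proof (cases "j = 1")
    case True
    then show ?thesis using less by simp
  next
    case False
    then obtain p where p: "prime p" "p dvd j" using prime_factor_nat by blast
    then obtain k where k: "j = p * k" by blast
    have "k < j" "k > 0" using k less.prems(1) p(1) prime_gt_1_nat[of p] by auto
    moreover have "coprime k L" "coprime p L" using less.prems(2) k by auto
    ultimately have 1: "ipoly r (z ^ k) = 0" using less by blast
    have "\<not> p dvd L" using \<open>coprime p L\<close> p(1)
      by (metis coprime_absorb_left not_prime_unit)
    moreover have "(z ^ k) ^ L = 1" by (metis z power_mult mult.commute power_one)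
    ultimately have "ipoly r ((z ^ k) ^ p) = 0"
      using ipoly_conjugate_prime[OF _ L p(1) _ 1] by blast
    then show ?thesis by (simp add: k power_mult[symmetric] mult.commute)
  qed
qed

section \<open>Linear independence of characters and the cyclotomic ring\<close>

text \<open>Subtracting \<open>\<psi> y\<close> times the relation at \<open>x\<close> from the
  relation at \<open>x * y\<close> removes \<open>\<psi>\<close> and leaves a shorter relation;
  \<open>y\<close> is chosen to separate \<open>\<psi>\<close> from the character under
  consideration.\<close>

lemma characters_independent:
  fixes X :: "('a::times \<Rightarrow> complex) set"
  assumes "finite X"
    and H: "\<And>x y. x \<in> H \<Longrightarrow> y \<in> H \<Longrightarrow> x * y \<in> H"
    and mult: "\<And>\<theta> x y. \<theta> \<in> X \<Longrightarrow> x \<in> H \<Longrightarrow> y \<in> H \<Longrightarrow> \<theta> (x * y) = \<theta> x * \<theta> y"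
    and nz: "\<And>\<theta>. \<theta> \<in> X \<Longrightarrow> \<exists>x\<in>H. \<theta> x \<noteq> 0"
    and distinct: "\<And>\<theta> \<psi>. \<theta> \<in> X \<Longrightarrow> \<psi> \<in> X \<Longrightarrow> \<theta> \<noteq> \<psi> \<Longrightarrow> \<exists>x\<in>H. \<theta> x \<noteq> \<psi> x"
    and sum: "\<And>x. x \<in> H \<Longrightarrow> (\<Sum>\<theta>\<in>X. a \<theta> * \<theta> x) = 0"
  shows "\<forall>\<theta>\<in>X. a \<theta> = 0"
  using assms(1) mult nz distinct sum
proof (induction X arbitrary: a rule: finite_induct)
  case empty
  then show ?case by simp
next
  case (insert \<psi> X)
  have X: "a \<theta> = 0" if \<theta>: "\<theta> \<in> X" for \<theta>
  proof -
    obtain y where y: "y \<in> H" "\<theta> y \<noteq> \<psi> y" using insert.prems(3)[of \<theta> \<psi>] \<theta> insert.hyps by blast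
    have "\<forall>\<phi>\<in>X. a \<phi> * (\<phi> y - \<psi> y) = 0"
    proof (rule insert.IH)
      fix x assume x: "x \<in> H"
      have 1: "a \<psi> * \<psi> x + (\<Sum>\<phi>\<in>X. a \<phi> * \<phi> x) = 0"
        using insert.prems(4)[OF x] insert.hyps by simp
      have "a \<psi> * (\<psi> x * \<psi> y) + (\<Sum>\<phi>\<in>X. a \<phi> * (\<phi> x * \<phi> y)) = 0"
        using insert.prems(4)[OF H[OF x y(1)]] insert.hyps insert.prems(1)[OF _ x y(1)] by simp
      moreover have "(\<Sum>\<phi>\<in>X. a \<phi> * (\<phi> y - \<psi> y) * \<phi> x) =
          (\<Sum>\<phi>\<in>X. a \<phi> * (\<phi> x * \<phi> y)) - \<psi> y * (\<Sum>\<phi>\<in>X. a \<phi> * \<phi> x)"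
        by (simp add: sum_distrib_left sum_subtractf[symmetric] algebra_simps)
      moreover have "\<psi> y * (\<Sum>\<phi>\<in>X. a \<phi> * \<phi> x) = - (a \<psi> * (\<psi> x * \<psi> y))"
      proof -
        have "(\<Sum>\<phi>\<in>X. a \<phi> * \<phi> x) = - (a \<psi> * \<psi> x)" using 1 by (simp add: add_eq_0_iff)
        then show ?thesis by (simp add: mult_ac)
      qed
      ultimately show "(\<Sum>\<phi>\<in>X. a \<phi> * (\<phi> y - \<psi> y) * \<phi> x) = 0" by (simp add: add.commute)
    qed (use insert.prems in auto)
    then show ?thesis using \<theta> y by auto
  qed
  obtain x where "x \<in> H" "\<psi> x \<noteq> 0" using insert.prems(2)[of \<psi>] by blast
  then have "a \<psi> = 0" using insert.prems(4)[of x] insert.hyps X by simp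
  then show ?case using X by simp
qed

text \<open>The indices are grouped by the restriction of \<open>\<theta> i\<close> to
  \<open>H\<close>. Independence of characters makes \<open>c\<close> sum to zero over each class,
  \<open>cd\<close> passes this on to \<open>d\<close>, and the classes are added up again.\<close>

lemma character_sum_transfer:
  fixes \<theta> :: "'i \<Rightarrow> 'a::times \<Rightarrow> complex"
  assumes fin: "finite I" and H: "\<And>x y. x \<in> H \<Longrightarrow> y \<in> H \<Longrightarrow> x * y \<in> H"
    and mult: "\<And>i x y. i \<in> I \<Longrightarrow> \<theta> i (x * y) = \<theta> i x * \<theta> i y"
    and e: "e \<in> H" "\<And>i. i \<in> I \<Longrightarrow> \<theta> i e \<noteq> 0"
    and cd: "\<And>A. A \<subseteq> I \<Longrightarrow> sum c A = 0 \<Longrightarrow> sum d A = (0::complex)"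
    and c: "\<And>x. x \<in> H \<Longrightarrow> (\<Sum>i\<in>I. c i * \<theta> i x) = 0"
    and x: "x \<in> H"
  shows "(\<Sum>i\<in>I. d i * \<theta> i x) = 0"
proof -
  \<comment> \<open>The value 0 outside \<open>H\<close> makes characters that agree on
    \<open>H\<close> equal as functions, so that the classes are the fibres of
    \<open>\<rho>\<close>.\<close>
  define \<rho> where "\<rho> = (\<lambda>i x. if x \<in> H then \<theta> i x else 0)"
  have gen: "(\<Sum>i\<in>I. g i * \<theta> i y) = (\<Sum>\<psi>\<in>\<rho> ` I. sum g {i \<in> I. \<rho> i = \<psi>} * \<psi> y)" if "y \<in> H" for g y
  proof -
    have "(\<Sum>i\<in>I. g i * \<theta> i y) = (\<Sum>i\<in>I. g i * \<rho> i y)" using that by (simp add: \<rho>_def)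
    also have "\<dots> = (\<Sum>\<psi>\<in>\<rho> ` I. \<Sum>i\<in>{i \<in> I. \<rho> i = \<psi>}. g i * \<rho> i y)"
      by (rule sum.image_gen[OF fin])
    also have "\<dots> = (\<Sum>\<psi>\<in>\<rho> ` I. sum g {i \<in> I. \<rho> i = \<psi>} * \<psi> y)"
      by (intro sum.cong refl) (simp add: sum_distrib_right)
    finally show ?thesis .
  qed
  have "\<forall>\<psi>\<in>\<rho> ` I. sum c {i \<in> I. \<rho> i = \<psi>} = 0"
  proof (rule characters_independent)
    show "finite (\<rho> ` I)" using fin by simp
    show "\<psi> (x * y) = \<psi> x * \<psi> y" if "\<psi> \<in> \<rho> ` I" "x \<in> H" "y \<in> H" for \<psi> x y
      using that H mult by (auto simp: \<rho>_def)
    show "\<exists>x\<in>H. \<psi> x \<noteq> 0" if \<psi>: "\<psi> \<in> \<rho> ` I" for \<psi>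
    proof -
      obtain i where "i \<in> I" "\<psi> = \<rho> i" using \<psi> by blast
      then show ?thesis using e by (intro bexI[of _ e]) (simp_all add: \<rho>_def)
    qed
    show "\<exists>x\<in>H. \<psi> x \<noteq> \<phi> x" if "\<psi> \<in> \<rho> ` I" "\<phi> \<in> \<rho> ` I" "\<psi> \<noteq> \<phi>" for \<psi> \<phi>
    proof (rule ccontr)
      assume "\<not> (\<exists>x\<in>H. \<psi> x \<noteq> \<phi> x)"
      then have "\<psi> x = \<phi> x" for x using that(1,2) by (cases "x \<in> H") (auto simp: \<rho>_def)
      then show False using that(3) by blast
    qed
    show "(\<Sum>\<psi>\<in>\<rho> ` I. sum c {i \<in> I. \<rho> i = \<psi>} * \<psi> y) = 0" if "y \<in> H" for y
      using gen[OF that, of c] c[OF that] by simp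
  qed (rule H)
  then have "sum d {i \<in> I. \<rho> i = \<psi>} = 0" if "\<psi> \<in> \<rho> ` I" for \<psi>
    using cd[of "{i \<in> I. \<rho> i = \<psi>}"] that by auto
  then show ?thesis using gen[OF x, of d] by simp
qed

text \<open>\<open>\<phi>\<close> is the image of \<open>a\<close> under a linear form that kills
  \<open>a i0\<close> and sends \<open>a i1\<close> to 1. The form is recorded through the relations
  over \<open>K\<close> that it must preserve, and is built by adding one index at a time.\<close>

lemma linear_extension:
  fixes K :: "complex set" and a :: "'i \<Rightarrow> complex"
  assumes K: "\<And>x y. x \<in> K \<Longrightarrow> y \<in> K \<Longrightarrow> x * y \<in> K" "\<And>x y. x \<in> K \<Longrightarrow> y \<in> K \<Longrightarrow> x - y \<in> K"
    and indep: "\<And>x y. x \<in> K \<Longrightarrow> y \<in> K \<Longrightarrow> x * a i0 + y * a i1 = 0 \<Longrightarrow> x = 0 \<and> y = 0"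
    and "finite I" "i0 \<in> I" "i1 \<in> I" "i0 \<noteq> i1"
  shows "\<exists>\<phi>. \<phi> i0 = 0 \<and> \<phi> i1 = (1::complex) \<and>
    (\<forall>k. (\<forall>i\<in>I. k i \<in> K) \<longrightarrow> (\<Sum>i\<in>I. k i * a i) = 0 \<longrightarrow> (\<Sum>i\<in>I. k i * \<phi> i) = 0)"
proof -
  have "\<exists>\<phi>. \<phi> i0 = 0 \<and> \<phi> i1 = (1::complex) \<and>
      (\<forall>k. (\<forall>i\<in>{i0, i1} \<union> J. k i \<in> K) \<longrightarrow> (\<Sum>i\<in>{i0, i1} \<union> J. k i * a i) = 0 \<longrightarrow>
        (\<Sum>i\<in>{i0, i1} \<union> J. k i * \<phi> i) = 0)"
    if "finite J" "i0 \<notin> J" "i1 \<notin> J" for J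
    using that
  proof (induction J rule: finite_induct)
    case empty
    show ?case
      by (rule exI[of _ "\<lambda>i. if i = i1 then 1 else 0"]) (use assms(7) indep in auto)
  next
    case (insert j J)
    then obtain \<phi> where \<phi>: "\<phi> i0 = 0" "\<phi> i1 = 1"
      "\<And>k. (\<forall>i\<in>{i0, i1} \<union> J. k i \<in> K) \<Longrightarrow> (\<Sum>i\<in>{i0, i1} \<union> J. k i * a i) = 0 \<Longrightarrow>
        (\<Sum>i\<in>{i0, i1} \<union> J. k i * \<phi> i) = 0" by auto
    let ?S = "{i0, i1} \<union> J"
    have j: "j \<notin> ?S" "finite ?S" "{i0, i1} \<union> insert j J = insert j ?S" using insert by auto
    have upd: "(\<Sum>i\<in>?S. k i * (\<phi>(j := t)) i) = (\<Sum>i\<in>?S. k i * \<phi> i)" for k t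
      using j(1) by (intro sum.cong) auto
    show ?case
    proof (cases "\<exists>k. (\<forall>i\<in>insert j ?S. k i \<in> K) \<and> (\<Sum>i\<in>insert j ?S. k i * a i) = 0 \<and> k j \<noteq> 0")
      case True
      then obtain k where k: "\<forall>i\<in>insert j ?S. k i \<in> K" "(\<Sum>i\<in>insert j ?S. k i * a i) = 0" "k j \<noteq> 0"
        by blast
      \<comment> \<open>The relation \<open>k\<close> forces this value at \<open>j\<close>; every
        other relation has to be shown consistent with it.\<close>
      define t where "t = - (\<Sum>i\<in>?S. k i * \<phi> i) / k j"
      have "(\<Sum>i\<in>insert j ?S. l i * (\<phi>(j := t)) i) = 0"
        if l: "\<forall>i\<in>insert j ?S. l i \<in> K" "(\<Sum>i\<in>insert j ?S. l i * a i) = 0" for l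
      proof -
        have ka: "k j * a j = - (\<Sum>i\<in>?S. k i * a i)" and la: "l j * a j = - (\<Sum>i\<in>?S. l i * a i)"
          using k(2) l(2) unfolding sum.insert[OF j(2,1)] by (simp_all only: add_eq_0_iff2)
        \<comment> \<open>Cross-multiplying the relations \<open>k\<close> and \<open>l\<close>
          eliminates the index \<open>j\<close>, so the induction hypothesis applies.\<close>
        have "(\<Sum>i\<in>?S. (k j * l i - l j * k i) * a i) =
            k j * (\<Sum>i\<in>?S. l i * a i) - l j * (\<Sum>i\<in>?S. k i * a i)"
          by (simp only: sum_distrib_left left_diff_distrib sum_subtractf mult.assoc)
        also have "\<dots> = k j * - (l j * a j) - l j * - (k j * a j)" by (simp only: ka la minus_minus)
        also have "\<dots> = 0" by simp
        finally have "(\<Sum>i\<in>?S. (k j * l i - l j * k i) * \<phi> i) = 0"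
          using k(1) l(1) K by (intro \<phi>(3)) auto
        moreover have "(\<Sum>i\<in>?S. (k j * l i - l j * k i) * \<phi> i) =
            k j * (\<Sum>i\<in>?S. l i * \<phi> i) - l j * (\<Sum>i\<in>?S. k i * \<phi> i)"
          by (simp only: sum_distrib_left left_diff_distrib sum_subtractf mult.assoc)
        ultimately have "k j * (\<Sum>i\<in>?S. l i * \<phi> i) = l j * (\<Sum>i\<in>?S. k i * \<phi> i)"
          by (simp only: right_minus_eq)
        moreover have "R + y * (- S / x) = 0" if "x * R = y * S" "x \<noteq> 0" for R S x y :: complex
          using that by (simp add: field_simps)
        ultimately have "(\<Sum>i\<in>?S. l i * \<phi> i) + l j * t = 0"
          using k(3) unfolding t_def by blast
        then show ?thesis unfolding sum.insert[OF j(2,1)] upd by (simp add: add.commute)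
      qed
      moreover have "(\<phi>(j := t)) i0 = 0" "(\<phi>(j := t)) i1 = 1" using \<phi>(1,2) insert.prems by simp_all
      ultimately show ?thesis unfolding j(3) by (intro exI[of _ "\<phi>(j := t)"] conjI allI impI)
    next
      case False
      \<comment> \<open>Every relation has coefficient 0 at \<open>j\<close>, so the value there is
        free.\<close>
      have "(\<Sum>i\<in>insert j ?S. l i * (\<phi>(j := 0)) i) = 0"
        if l: "\<forall>i\<in>insert j ?S. l i \<in> K" "(\<Sum>i\<in>insert j ?S. l i * a i) = 0" for l
      proof -
        have "l j = 0" using False l by blast
        then have "(\<Sum>i\<in>?S. l i * a i) = 0" using l(2) unfolding sum.insert[OF j(2,1)] by simp
        then have "(\<Sum>i\<in>?S. l i * \<phi> i) = 0" using l(1) by (intro \<phi>(3)) auto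
        then show ?thesis unfolding sum.insert[OF j(2,1)] upd by simp
      qed
      moreover have "(\<phi>(j := 0)) i0 = 0" "(\<phi>(j := 0)) i1 = 1" using \<phi>(1,2) insert.prems by simp_all
      ultimately show ?thesis unfolding j(3) by (intro exI[of _ "\<phi>(j := 0)"] conjI allI impI)
    qed
  qed
  note step = this[of "I - {i0, i1}"]
  have I: "{i0, i1} \<union> (I - {i0, i1}) = I" using assms(5,6) by blast
  show ?thesis using step unfolding I using assms(4) by simp
qed

section \<open>Roots of unity and the ring they generate\<close>

definition root_of_unity :: "nat \<Rightarrow> complex" where
  "root_of_unity N = cis (2 * pi / N)"

lemma root_of_unity_power: "root_of_unity N ^ k = cis (2 * pi * k / N)"
  by (simp add: root_of_unity_def DeMoivre mult_ac)

lemma root_of_unity_power_self [simp]: "N > 0 \<Longrightarrow> root_of_unity N ^ N = 1"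
  by (simp add: root_of_unity_power)

lemma root_of_unity_mult: "M > 0 \<Longrightarrow> root_of_unity (N * M) ^ M = root_of_unity N"
  by (simp add: root_of_unity_def DeMoivre)

lemma root_of_unity_dvd: "N dvd M \<Longrightarrow> M > 0 \<Longrightarrow> root_of_unity N = root_of_unity M ^ (M div N)"
  by (elim dvdE) (auto simp: root_of_unity_mult)

lemma root_of_unity_exhaust:
  assumes "z ^ N = 1" "N > 0"
  shows "\<exists>k. z = root_of_unity N ^ k"
proof -
  have "z \<in> (\<lambda>k. cis (2 * pi * real k / real N)) ` {..<N}"
    using bij_betw_roots_unity[OF assms(2)] assms(1) by (auto simp: bij_betw_def)
  then show ?thesis by (auto simp: root_of_unity_power)
qed

lemma root_of_unity_power_eq_1:
  assumes "N > 0"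
  shows "root_of_unity N ^ k = 1 \<longleftrightarrow> N dvd k"
proof
  assume 1: "root_of_unity N ^ k = 1"
  have "root_of_unity N ^ k = root_of_unity N ^ (N * (k div N) + k mod N)" by simp
  also have "\<dots> = root_of_unity N ^ (k mod N)"
    using assms by (simp only: power_add power_mult root_of_unity_power_self power_one mult_1)
  finally have "cis (2 * pi * real (k mod N) / N) = cis (2 * pi * real 0 / N)"
    using 1 by (simp add: root_of_unity_power)
  moreover have "inj_on (\<lambda>k. cis (2 * pi * real k / real N)) {..<N}"
    using bij_betw_roots_unity[OF assms] by (simp add: bij_betw_def)
  ultimately have "k mod N = 0" using assms inj_onD[of "\<lambda>k. cis (2 * pi * real k / real N)" "{..<N}" "k mod N" 0] by simp
  then show "N dvd k" by auto
next
  assume "N dvd k"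
  then show "root_of_unity N ^ k = 1" using assms by (auto simp: power_mult)
qed

lemma root_of_unity_half:
  assumes "even L" "L > 0"
  shows "root_of_unity L ^ (L div 2) = - 1"
proof -
  have "(root_of_unity L ^ (L div 2))\<^sup>2 = 1" using assms by (simp flip: power_mult)
  moreover have "root_of_unity L ^ (L div 2) \<noteq> 1"
    using assms by (auto simp: root_of_unity_power_eq_1 dest!: dvd_imp_le)
  ultimately show ?thesis by (simp add: power2_eq_1_iff)
qed

text \<open>The ring generated by all roots of unity, as the union of the rings
  \<open>\<int>[\<zeta>\<^sub>N]\<close>.\<close>

definition cyclotomic_ring :: "complex set" where
  "cyclotomic_ring = {ipoly p (root_of_unity N) | p N. N > 0}"

lemma ipoly_root_of_unity_dvd:
  assumes "N dvd M" "M > 0"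
  shows "ipoly p (root_of_unity N) = ipoly (pcompose p (monom 1 (M div N))) (root_of_unity M)"
  using root_of_unity_dvd[OF assms] by simp

lemma cyclotomic_ring_common:
  assumes "finite Z" "Z \<subseteq> cyclotomic_ring"
  shows "\<exists>N>0. \<forall>z\<in>Z. \<exists>p. z = ipoly p (root_of_unity N)"
  using assms
proof (induction Z rule: finite_induct)
  case empty
  show ?case by (intro exI[of _ 1]) simp
next
  case (insert z Z)
  have "Z \<subseteq> cyclotomic_ring" using insert.prems by simp
  then obtain N where N: "N > 0" "\<forall>z\<in>Z. \<exists>p. z = ipoly p (root_of_unity N)"
    using insert.IH by blast
  obtain M p where M: "M > 0" "z = ipoly p (root_of_unity M)"
    using insert.prems unfolding cyclotomic_ring_def by blast
  have "\<exists>p. y = ipoly p (root_of_unity (N * M))" if y: "y \<in> insert z Z" for y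
  proof (cases "y = z")
    case True
    have "M dvd N * M" "N * M > 0" using M(1) N(1) by simp_all
    then have "y = ipoly (pcompose p (monom 1 (N * M div M))) (root_of_unity (N * M))"
      unfolding True M(2) by (rule ipoly_root_of_unity_dvd)
    then show ?thesis by (rule exI)
  next
    case False
    then have "y \<in> Z" using y by simp
    then obtain q where q: "y = ipoly q (root_of_unity N)" using N(2) by blast
    have "N dvd N * M" "N * M > 0" using M(1) N(1) by simp_all
    then have "y = ipoly (pcompose q (monom 1 (N * M div N))) (root_of_unity (N * M))"
      unfolding q by (rule ipoly_root_of_unity_dvd)
    then show ?thesis by (rule exI)
  qed
  then show ?case using N(1) M(1) by (intro exI[of _ "N * M"]) simp
qed

lemma cyclotomic_ring_common2:
  assumes "x \<in> cyclotomic_ring" "y \<in> cyclotomic_ring"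
  obtains N p q where "N > 0" "x = ipoly p (root_of_unity N)" "y = ipoly q (root_of_unity N)"
proof -
  have "finite {x, y}" "{x, y} \<subseteq> cyclotomic_ring" using assms by simp_all
  then obtain N where N: "N > 0" "\<forall>z\<in>{x, y}. \<exists>p. z = ipoly p (root_of_unity N)"
    using cyclotomic_ring_common by blast
  obtain p where p: "x = ipoly p (root_of_unity N)" using N(2) by blast
  obtain q where q: "y = ipoly q (root_of_unity N)" using N(2) by blast
  show thesis using N(1) p q by (rule that)
qed

lemma cyclotomic_ring_diff: "x \<in> cyclotomic_ring \<Longrightarrow> y \<in> cyclotomic_ring \<Longrightarrow> x - y \<in> cyclotomic_ring"
proof (erule (1) cyclotomic_ring_common2)
  fix N p q assume "N > 0" "x = ipoly p (root_of_unity N)" "y = ipoly q (root_of_unity N)"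
  then have "x - y = ipoly (p - q) (root_of_unity N)" by simp
  then show ?thesis using \<open>N > 0\<close> unfolding cyclotomic_ring_def by blast
qed

lemma cyclotomic_ring_mult: "x \<in> cyclotomic_ring \<Longrightarrow> y \<in> cyclotomic_ring \<Longrightarrow> x * y \<in> cyclotomic_ring"
proof (erule (1) cyclotomic_ring_common2)
  fix N p q assume "N > 0" "x = ipoly p (root_of_unity N)" "y = ipoly q (root_of_unity N)"
  then have "x * y = ipoly (p * q) (root_of_unity N)" by simp
  then show ?thesis using \<open>N > 0\<close> unfolding cyclotomic_ring_def by blast
qed

lemma cyclotomic_ring_root:
  assumes "z ^ N = 1" "N > 0"
  shows "z \<in> cyclotomic_ring"
proof -
  obtain k where "z = root_of_unity N ^ k" using root_of_unity_exhaust assms by blast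
  then have "z = ipoly (monom 1 k) (root_of_unity N)" by simp
  then show ?thesis using assms(2) unfolding cyclotomic_ring_def by blast
qed

lemma cyclotomic_ring_0: "0 \<in> cyclotomic_ring"
  using cyclotomic_ring_diff[of 1 1] cyclotomic_ring_root[of 1 1] by simp

lemma cyclotomic_ring_prod: "(\<And>i. i \<in> I \<Longrightarrow> g i \<in> cyclotomic_ring) \<Longrightarrow> (\<Prod>i\<in>I. g i) \<in> cyclotomic_ring"
  by (induction I rule: infinite_finite_induct)
    (auto intro: cyclotomic_ring_mult cyclotomic_ring_root[of 1 1])

lemma cyclotomic_ring_power: "x \<in> cyclotomic_ring \<Longrightarrow> x ^ n \<in> cyclotomic_ring"
  using cyclotomic_ring_prod[of "{..<n}" "\<lambda>_. x"] by simp

lemma ipoly_even_odd: "\<exists>u v. \<forall>z. ipoly q z = ipoly u (z\<^sup>2) + z * ipoly v (z\<^sup>2)"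
proof (induction q)
  case (pCons a q)
  then obtain u v where "\<And>z. ipoly q z = ipoly u (z\<^sup>2) + z * ipoly v (z\<^sup>2)" by blast
  then have "\<forall>z. ipoly (pCons a q) z = ipoly (pCons a v) (z\<^sup>2) + z * ipoly u (z\<^sup>2)"
    by (simp add: algebra_simps power2_eq_square)
  then show ?case by blast
qed (auto intro!: exI[of _ 0])

text \<open>The odd part changes sign from \<open>z\<close> to \<open>- z\<close>, so it vanishes.
  This is the descent to half the level.\<close>

lemma ipoly_even:
  assumes "ipoly q (- z) = ipoly q z"
  shows "\<exists>u. ipoly q z = ipoly u (z\<^sup>2)"
proof -
  obtain u v where uv: "\<And>z. ipoly q z = ipoly u (z\<^sup>2) + z * ipoly v (z\<^sup>2)"
    using ipoly_even_odd by blast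
  have "z * ipoly v (z\<^sup>2) = 0" using assms uv[of z] uv[of "- z"] by simp
  then show ?thesis using uv[of z] by auto
qed

section \<open>Monomials at points of the torus\<close>

definition mono_at :: "('n::finite \<Rightarrow>\<^sub>0 nat) \<Rightarrow> complex ^ 'n \<Rightarrow> complex" where
  "mono_at m x = (\<Prod>i\<in>UNIV. (x $ i) ^ lookup m i)"

lemma mono_at_add: "mono_at (a + b) x = mono_at a x * mono_at b x"
  by (simp add: mono_at_def lookup_add power_add prod.distrib)

lemma mono_at_mult: "mono_at m (x * y) = mono_at m x * mono_at m y"
  by (simp add: mono_at_def power_mult_distrib prod.distrib)

lemma mono_at_1: "mono_at m 1 = 1"
  by (simp add: mono_at_def)

lemma mono_at_nonzero: "(\<And>i. x $ i \<noteq> 0) \<Longrightarrow> mono_at m x \<noteq> 0"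
  by (simp add: mono_at_def)

lemma mono_at_power: "mono_at m x ^ j = mono_at m (\<chi> i. x $ i ^ j)"
  by (simp add: mono_at_def prod_power_distrib power_mult[symmetric] mult.commute)

lemma poly_eval_superset:
  assumes "finite A" "keys p \<subseteq> A"
  shows "poly_eval p x = (\<Sum>m\<in>A. lookup p m * mono_at m x)"
  unfolding poly_eval_def mono_at_def
  using assms by (intro sum.mono_neutral_left) (auto simp: in_keys_iff)

lemma poly_eval_keys: "poly_eval p x = (\<Sum>m\<in>keys p. lookup p m * mono_at m x)"
  by (rule poly_eval_superset) simp_all

lemma poly_eval_add: "poly_eval (p + q) x = poly_eval p x + poly_eval q x"
  using poly_eval_superset[of "keys p \<union> keys q" "p + q" x] keys_add[of p q]
    poly_eval_superset[of "keys p \<union> keys q" p x] poly_eval_superset[of "keys p \<union> keys q" q x]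
  by (simp add: lookup_add distrib_right sum.distrib)

lemma poly_eval_single: "poly_eval (single m c) x = c * mono_at m x"
  by (cases "c = 0") (simp_all add: poly_eval_def mono_at_def)

lemma poly_eval_sum_single:
  "finite I \<Longrightarrow> poly_eval (\<Sum>m\<in>I. single (e m) (c m)) x = (\<Sum>m\<in>I. c m * mono_at (e m) x)"
  by (induction I rule: finite_induct)
    (simp_all add: poly_eval_add poly_eval_single, simp add: poly_eval_def)

lemma keys_sum_single: "keys (\<Sum>m\<in>I. single (e m) (c m)) \<subseteq> e ` I"
proof (induction I rule: infinite_finite_induct)
  case (insert m I)
  then show ?case using keys_add[of "single (e m) (c m)" "\<Sum>m\<in>I. single (e m) (c m)"]
    by (auto split: if_splits)
qed simp_all

lemma total_degree_sum_single_le: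
  "(\<And>m. m \<in> I \<Longrightarrow> mdeg (e m) \<le> d) \<Longrightarrow> total_degree (\<Sum>m\<in>I. single (e m) (c m)) \<le> d"
  using keys_sum_single[of e c I] by (intro total_degree_le) auto

lemma lookup_sum_single:
  assumes "finite I" "inj e"
  shows "lookup (\<Sum>m\<in>I. single (e m) (c m)) (e k) = (if k \<in> I then c k else 0)"
proof -
  have "lookup (\<Sum>m\<in>I. single (e m) (c m)) (e k) = (\<Sum>m\<in>I. if m = k then c k else 0)"
    unfolding lookup_sum using inj_eq[OF assms(2)] by (intro sum.cong) (auto simp: lookup_single when_def)
  then show ?thesis using assms(1) by simp
qed

text \<open>A vector of signs is encoded by the set \<open>E\<close> of its coordinates equal to -1;
  this is the value of the monomial at that vector.\<close>

definition sign_at :: "'n set \<Rightarrow> ('n \<Rightarrow>\<^sub>0 nat) \<Rightarrow> complex" where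
  "sign_at E m = (- 1) ^ (\<Sum>i\<in>E. lookup m i)"

lemma sign_at_add: "sign_at E (a + b) = sign_at E a * sign_at E b"
  by (simp add: sign_at_def lookup_add sum.distrib power_add)

lemma sign_at_square: "sign_at E m * sign_at E m = 1"
  by (simp add: sign_at_def flip: power_mult_distrib)

lemma sign_at_nonzero: "sign_at E m \<noteq> 0"
  by (simp add: sign_at_def)

lemma sign_at_disjoint:
  "finite D \<Longrightarrow> finite E \<Longrightarrow> D \<inter> E = {} \<Longrightarrow> sign_at (D \<union> E) m = sign_at D m * sign_at E m"
  by (simp add: sign_at_def sum.union_disjoint power_add)

lemma sign_at_eq_iff: "sign_at E a = sign_at E b \<longleftrightarrow> even (\<Sum>i\<in>E. int (lookup a i) - int (lookup b i))"
proof -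
  have "(\<Sum>i\<in>E. int (lookup a i) - int (lookup b i)) =
      int (\<Sum>i\<in>E. lookup a i) - int (\<Sum>i\<in>E. lookup b i)"
    by (simp add: sum_subtractf)
  then have "even (\<Sum>i\<in>E. int (lookup a i) - int (lookup b i)) \<longleftrightarrow>
      (even (\<Sum>i\<in>E. lookup a i) \<longleftrightarrow> even (\<Sum>i\<in>E. lookup b i))"
    by (simp del: of_nat_sum)
  then show ?thesis
    unfolding sign_at_def by (simp add: uminus_power_if)
qed

lemma mono_at_sign:
  assumes "\<And>i. u $ i = 1 \<or> u $ i = - 1"
  shows "mono_at m u = sign_at {i. u $ i \<noteq> 1} m"
proof -
  have "mono_at m u = (\<Prod>i\<in>UNIV. if i \<in> {i. u $ i \<noteq> 1} then (- 1) ^ lookup m i else 1)"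
    unfolding mono_at_def using assms by (intro prod.cong refl) (auto, metis power_one)
  also have "\<dots> = (\<Prod>i\<in>{i. u $ i \<noteq> 1}. (- 1) ^ lookup m i)"
    by (simp add: prod.If_cases)
  finally show ?thesis by (simp add: sign_at_def power_sum)
qed

text \<open>A constant sign makes the coordinate sum over \<open>E\<close> even on all differences
  of support points, hence on the lattice they generate, which is everything. A unit vector at a
  coordinate in \<open>E\<close> contradicts this.\<close>

lemma sign_at_const_on_keys:
  fixes f :: "'n::finite mpoly"
  assumes "exponent_lattice f = UNIV" and const: "\<And>m. m \<in> keys f \<Longrightarrow> sign_at E m = k"
  shows "E = {}"
proof (rule ccontr)
  assume "E \<noteq> {}"
  then obtain j where j: "j \<in> E" by blast
  have even: "even (\<Sum>i\<in>E. v $ i)" if v: "v \<in> exponent_lattice f" for v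
    using v unfolding exponent_lattice_def
  proof (induction rule: group_closure.induct)
    case (base s)
    then consider "s = 0" | a b where "s = a - b" "a \<in> support f" "b \<in> support f" by blast
    then show ?case
    proof cases
      case 2
      then obtain a' b' where "a' \<in> keys f" "b' \<in> keys f"
        "a = (\<chi> i. int (lookup a' i))" "b = (\<chi> i. int (lookup b' i))"
        by (auto simp: support_def)
      moreover then have "sign_at E a' = sign_at E b'" using const by simp
      ultimately show ?thesis using 2(1) by (simp add: sign_at_eq_iff)
    qed simp
  next
    case (diff s t)
    then show ?case by (simp add: sum_subtractf)
  qed
  have "even (\<Sum>i\<in>E. (\<chi> i. if i = j then 1 else (0 :: int)) $ i)"
    using assms(1) by (intro even) simp
  then show False using j by simp
qed

text \<open>The sign change keeps the degree, so divisibility would make the two polynomials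
  proportional and the sign constant on the support.\<close>

lemma not_dvd_scale_sign:
  fixes f :: "'n::finite mpoly"
  assumes "exponent_lattice f = UNIV" "f \<noteq> 0" "E \<noteq> {}"
  shows "\<not> f dvd scale_coeffs (sign_at E) f"
proof
  assume dvd: "f dvd scale_coeffs (sign_at E) f"
  have keys: "keys (scale_coeffs (sign_at E) f) = keys f"
    by (auto simp: in_keys_iff sign_at_nonzero)
  then have "scale_coeffs (sign_at E) f \<noteq> 0"
    using assms(2) poly_mapping_eqI[of f 0] by (metis keys_zero poly_mapping_sum_single sum.empty)
  moreover have "total_degree (scale_coeffs (sign_at E) f) \<le> total_degree f"
    by (simp add: total_degree_def keys)
  ultimately obtain k where k: "\<And>m. sign_at E m * lookup f m = k * lookup f m"
    using dvd_total_degree_le[OF dvd] by auto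
  have "sign_at E m = k" if "m \<in> keys f" for m
    using k[of m] that by (simp add: in_keys_iff)
  then show False using sign_at_const_on_keys[OF assms(1)] assms(3) by blast
qed

lemma irreducible_no_common_factor:
  fixes f F g :: "'a::comm_ring_1"
  assumes "irreducible f" "\<not> f dvd F" "g dvd f" "g dvd F"
  shows "g dvd 1"
proof -
  obtain h where h: "f = g * h" using assms(3) by (rule dvdE)
  then have "g dvd 1 \<or> h dvd 1" using assms(1) by (simp add: irreducible_def)
  moreover have False if unit: "h dvd 1"
  proof -
    obtain u where "1 = h * u" using unit by (rule dvdE)
    then have "g = f * u" using h by (simp add: mult.assoc)
    then have "f dvd g" by simp
    then show False using assms(2,4) dvd_trans by blast
  qed
  ultimately show ?thesis by blast
qed

text \<open>The coefficients of \<open>c f(\<tau> X)\<close> lie in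
  \<open>\<int>[\<zeta>\<^sub>N]\<close>. The freedom in \<open>c\<close> and \<open>\<tau>\<close>
  is what gives the least \<open>N\<close> its force.\<close>

definition has_cyclotomic_form :: "'n::finite mpoly \<Rightarrow> nat \<Rightarrow> bool" where
  "has_cyclotomic_form f N \<longleftrightarrow> N > 0 \<and> (\<exists>c \<tau> p. c \<noteq> 0 \<and> (\<forall>i. \<exists>k>0. \<tau> $ i ^ k = 1) \<and>
     (\<forall>m\<in>keys f. c * lookup f m * mono_at m \<tau> = ipoly (p m) (root_of_unity N)))"

lemma torsion_exponent:
  fixes u :: "complex ^ 'n::finite"
  assumes "\<And>i. \<exists>k>0. u $ i ^ k = 1"
  shows "\<exists>k>0. \<forall>i. u $ i ^ k = 1"
proof -
  obtain k where k: "\<And>i. k i > 0" "\<And>i. u $ i ^ k i = 1" using assms by metis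
  have "u $ i ^ (\<Prod>i\<in>UNIV. k i) = 1" for i
  proof -
    have "(\<Prod>i\<in>UNIV. k i) = k i * (\<Prod>j\<in>UNIV - {i}. k j)" by (simp add: prod.remove)
    then show ?thesis using k(2)[of i] by (simp add: power_mult)
  qed
  moreover have "(\<Prod>i\<in>UNIV. k i) > 0" using k(1) by (simp add: prod_pos)
  ultimately show ?thesis by blast
qed

lemma torsion_nonzero: "\<exists>k>0. z ^ k = 1 \<Longrightarrow> z \<noteq> (0::complex)"
  by (auto simp: power_0_left split: if_splits)

lemma torsion_cosetE:
  assumes "torsion_coset C" "C \<subseteq> hypersurface f"
  obtains w H where "\<And>i. \<exists>k>0. (w $ i) ^ k = 1" "1 \<in> H" "\<And>x y. x \<in> H \<Longrightarrow> y \<in> H \<Longrightarrow> x * y \<in> H"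
    "\<And>x i. x \<in> H \<Longrightarrow> x $ i \<noteq> 0" "C = {w * x | x. x \<in> H}" "\<And>x. x \<in> H \<Longrightarrow> poly_eval f (w * x) = 0"
proof -
  obtain w H where wH: "\<forall>i. \<exists>k>0. (w $ i) ^ k = 1" "subtorus H" "C = w <#\<^bsub>torus\<^esub> H"
    using assms(1) unfolding torsion_coset_def by blast
  have H: "subgroup H torus" using wH(2) by (simp add: subtorus_def)
  have C: "C = {w * x | x. x \<in> H}" using wH(3) by (auto simp: l_coset_def torus_def)
  show thesis
  proof (rule that[OF _ _ _ _ C])
    show "\<exists>k>0. (w $ i) ^ k = 1" for i using wH(1) by blast
    show "1 \<in> H" using subgroup.one_closed[OF H] by (simp add: torus_def)
    show "x * y \<in> H" if "x \<in> H" "y \<in> H" for x y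
      using subgroup.m_closed[OF H that] by (simp add: torus_def)
    show "x $ i \<noteq> 0" if "x \<in> H" for x i
      using subgroup.subset[OF H] that by (auto simp: torus_def)
    show "poly_eval f (w * x) = 0" if "x \<in> H" for x
      using assms(2) C that by (auto simp: hypersurface_def)
  qed
qed

lemma coset_subset_hypersurface:
  fixes w :: "complex ^ 'n::finite"
  assumes "\<And>i. \<exists>k>0. (w $ i) ^ k = 1" "\<And>x i. x \<in> H \<Longrightarrow> x $ i \<noteq> 0"
    and "\<And>x. x \<in> H \<Longrightarrow> poly_eval F (w * x) = 0"
  shows "{w * x | x. x \<in> H} \<subseteq> hypersurface F"
  using assms(2,3) torsion_nonzero[OF assms(1)] by (auto simp: hypersurface_def torus_def)

text \<open>Two coefficients of \<open>f\<close> are independent over the cyclotomic ring. A linear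
  form that kills the first and not the second yields a polynomial not proportional to
  \<open>f\<close>, and it respects the relations over that ring which express vanishing on a
  torsion coset.\<close>

lemma non_cyclotomic_case:
  fixes f :: "'n::finite mpoly"
  assumes "irreducible f" and no_form: "\<And>N. \<not> has_cyclotomic_form f N"
  shows "\<exists>F. total_degree F \<le> total_degree f \<and> \<not> f dvd F \<and>
    (\<forall>C. torsion_coset C \<longrightarrow> C \<subseteq> hypersurface f \<longrightarrow> C \<subseteq> hypersurface F)"
proof -
  let ?K = cyclotomic_ring
  have f0: "f \<noteq> 0" using assms(1) by (simp add: irreducible_def)
  then have "keys f \<noteq> {}" using poly_mapping_sum_single[of f] by auto
  then obtain m0 where m0: "m0 \<in> keys f" by blast
  have "\<exists>m1\<in>keys f. \<forall>x\<in>?K. \<forall>y\<in>?K. x * lookup f m0 + y * lookup f m1 = 0 \<longrightarrow> x = 0 \<and> y = 0"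
  proof (rule ccontr)
    assume "\<not> ?thesis"
    then have "\<forall>m\<in>keys f. \<exists>xy. fst xy \<in> ?K \<and> snd xy \<in> ?K \<and>
        fst xy * lookup f m0 + snd xy * lookup f m = 0 \<and> \<not> (fst xy = 0 \<and> snd xy = 0)"
      by (auto simp: Bex_def)
    then obtain xy where xy: "\<forall>m\<in>keys f. fst (xy m) \<in> ?K \<and> snd (xy m) \<in> ?K \<and>
        fst (xy m) * lookup f m0 + snd (xy m) * lookup f m = 0 \<and> \<not> (fst (xy m) = 0 \<and> snd (xy m) = 0)"
      by (metis bchoice)
    define x y where "x = (\<lambda>m. fst (xy m))" and "y = (\<lambda>m. snd (xy m))"
    have xK: "x m \<in> ?K" and yK: "y m \<in> ?K" and eq: "x m * lookup f m0 + y m * lookup f m = 0"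
      and xy0: "x m \<noteq> 0 \<or> y m \<noteq> 0" if "m \<in> keys f" for m
      using xy that unfolding x_def y_def by blast+
    have y0: "y m \<noteq> 0" if "m \<in> keys f" for m
      using eq[OF that] xy0[OF that] m0 by (auto simp: in_keys_iff)
    \<comment> \<open>The ratios to the coefficient at \<open>m0\<close> are
      \<open>- x m / y m\<close>, so the product of the \<open>y m\<close> is a common
      denominator.\<close>
    define c where "c = (\<Prod>m\<in>keys f. y m) / lookup f m0"
    have c0: "c \<noteq> 0" using y0 m0 by (auto simp: c_def in_keys_iff)
    have "c * lookup f m \<in> ?K" if m: "m \<in> keys f" for m
    proof -
      have "y m * lookup f m = - x m * lookup f m0" using eq[OF m] by (simp add: eq_neg_iff_add_eq_0 add.commute)
      moreover have "c * lookup f m = (\<Prod>k\<in>keys f - {m}. y k) * (y m * lookup f m) / lookup f m0"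
        using m by (simp add: c_def prod.remove[of _ m])
      ultimately have "c * lookup f m = (\<Prod>k\<in>keys f - {m}. y k) * (0 - x m)"
        using m0 by (simp add: in_keys_iff)
      also have "\<dots> \<in> ?K" using m xK yK cyclotomic_ring_0
        by (intro cyclotomic_ring_mult cyclotomic_ring_prod cyclotomic_ring_diff) auto
      finally show ?thesis .
    qed
    then have "(\<lambda>m. c * lookup f m) ` keys f \<subseteq> ?K" by blast
    then obtain N where N: "N > 0" "\<forall>z\<in>(\<lambda>m. c * lookup f m) ` keys f. \<exists>p. z = ipoly p (root_of_unity N)"
      using cyclotomic_ring_common[of "(\<lambda>m. c * lookup f m) ` keys f"] by auto
    then have "\<forall>m\<in>keys f. \<exists>p. c * lookup f m = ipoly p (root_of_unity N)" by simp
    then obtain p where p: "\<forall>m\<in>keys f. c * lookup f m = ipoly (p m) (root_of_unity N)"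
      by (metis bchoice)
    have "has_cyclotomic_form f N"
      unfolding has_cyclotomic_form_def
    proof (intro conjI exI)
      show "\<forall>i. \<exists>k>0. (1 :: complex ^ 'n) $ i ^ k = 1" by auto
      show "\<forall>m\<in>keys f. c * lookup f m * mono_at m 1 = ipoly (p m) (root_of_unity N)"
        using p by (simp add: mono_at_1)
    qed (use N c0 in auto)
    then show False using no_form by blast
  qed
  then obtain m1 where m1: "m1 \<in> keys f"
    and indep: "\<And>x y. x \<in> ?K \<Longrightarrow> y \<in> ?K \<Longrightarrow> x * lookup f m0 + y * lookup f m1 = 0 \<Longrightarrow> x = 0 \<and> y = 0"
    by blast
  have K1: "1 \<in> ?K" using cyclotomic_ring_root[of 1 1] by simp
  have "m0 \<noteq> m1"
  proof
    assume "m0 = m1"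
    then have "1 * lookup f m0 + (0 - 1) * lookup f m1 = 0" by simp
    then show False using indep[OF K1 cyclotomic_ring_diff[OF cyclotomic_ring_0 K1]] by simp
  qed
  then obtain \<phi> where \<phi>: "\<phi> m0 = 0" "\<phi> m1 = (1::complex)"
    "\<And>k. (\<forall>m\<in>keys f. k m \<in> ?K) \<Longrightarrow> (\<Sum>m\<in>keys f. k m * lookup f m) = 0 \<Longrightarrow>
      (\<Sum>m\<in>keys f. k m * \<phi> m) = 0"
    using linear_extension[of ?K "lookup f" m0 m1 "keys f"] m0 m1 indep
      cyclotomic_ring_mult cyclotomic_ring_diff by auto
  define F where "F = (\<Sum>m\<in>keys f. single m (\<phi> m))"
  have lookup_F: "lookup F m = (if m \<in> keys f then \<phi> m else 0)" for m
    unfolding F_def using lookup_sum_single[of "keys f" "\<lambda>m. m" \<phi> m] by (simp add: inj_def)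
  have degF: "total_degree F \<le> total_degree f"
    unfolding F_def by (intro total_degree_sum_single_le mdeg_le_total_degree)
  have F0: "F \<noteq> 0" using lookup_F[of m1] m1 \<phi>(2) by auto
  have "\<not> f dvd F"
  proof
    assume "f dvd F"
    then obtain k where k: "k \<noteq> 0" "\<And>m. lookup F m = k * lookup f m"
      using dvd_total_degree_le[OF _ F0 degF] by blast
    then show False using lookup_F[of m0] \<phi>(1) m0 by (simp add: in_keys_iff)
  qed
  moreover have "C \<subseteq> hypersurface F" if C: "torsion_coset C" "C \<subseteq> hypersurface f" for C
  proof -
    obtain w H where w: "\<And>i. \<exists>k>0. (w $ i) ^ k = 1"
      and H: "1 \<in> H" "\<And>x y. x \<in> H \<Longrightarrow> y \<in> H \<Longrightarrow> x * y \<in> H" "\<And>x i. x \<in> H \<Longrightarrow> x $ i \<noteq> 0"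
      and CwH: "C = {w * x | x. x \<in> H}" and van: "\<And>x. x \<in> H \<Longrightarrow> poly_eval f (w * x) = 0"
      using torsion_cosetE[OF C] by blast
    have wK: "mono_at m w \<in> ?K" for m
      unfolding mono_at_def using w cyclotomic_ring_root
      by (intro cyclotomic_ring_prod cyclotomic_ring_power) blast
    have "poly_eval F (w * x) = 0" if x: "x \<in> H" for x
    proof -
      have "(\<Sum>m\<in>keys f. \<phi> m * mono_at m w * mono_at m x) = 0"
      proof (rule character_sum_transfer[OF _ H(2) _ H(1)])
        show "(\<Sum>m\<in>A. \<phi> m * mono_at m w) = 0"
          if A: "A \<subseteq> keys f" "(\<Sum>m\<in>A. lookup f m * mono_at m w) = 0" for A
        proof -
          \<comment> \<open>The indicator of \<open>A\<close> turns the sum over one class into a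
            relation over all of \<open>keys f\<close>, with coefficients in the cyclotomic
            ring.\<close>
          have ext: "(\<Sum>m\<in>keys f. (if m \<in> A then mono_at m w else 0) * g m) = (\<Sum>m\<in>A. g m * mono_at m w)"
            for g using A(1) by (intro sum.mono_neutral_cong_right) auto
          have "(\<Sum>m\<in>keys f. (if m \<in> A then mono_at m w else 0) * \<phi> m) = 0"
            using ext A(2) wK cyclotomic_ring_0 by (intro \<phi>(3)) simp_all
          then show ?thesis using ext by simp
        qed
        show "(\<Sum>m\<in>keys f. lookup f m * mono_at m w * mono_at m y) = 0" if "y \<in> H" for y
          using van[OF that] by (simp add: poly_eval_keys mono_at_mult mult.assoc)
      qed (use x in \<open>simp_all add: mono_at_mult mono_at_1\<close>)
      then show ?thesis by (simp add: F_def poly_eval_sum_single mono_at_mult mult.assoc)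
    qed
    then show ?thesis unfolding CwH by (intro coset_subset_hypersurface w H(3))
  qed
  ultimately show ?thesis using degF by blast
qed

section \<open>Polynomials with cyclotomic coefficients\<close>

text \<open>\<open>N\<close> is least over all scalars and all torsion translations, not only for
  the given \<open>c\<close> and \<open>\<tau>\<close>.\<close>

locale cyclotomic_form =
  fixes f :: "'n::finite mpoly" and N :: nat and c :: complex and \<tau> :: "complex ^ 'n"
    and p :: "('n \<Rightarrow>\<^sub>0 nat) \<Rightarrow> int poly"
  assumes irreducible: "irreducible f"
    and lattice: "exponent_lattice f = UNIV"
    and N: "N > 0" and c: "c \<noteq> 0" and \<tau>: "\<And>i. \<exists>k>0. \<tau> $ i ^ k = 1"
    and form: "\<And>m. m \<in> keys f \<Longrightarrow> c * lookup f m * mono_at m \<tau> = ipoly (p m) (root_of_unity N)"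
    and minimal: "\<And>M. has_cyclotomic_form f M \<Longrightarrow> N \<le> M"
begin

abbreviation \<zeta> :: complex where "\<zeta> \<equiv> root_of_unity N"

definition \<sigma> :: "complex ^ 'n" where "\<sigma> = (\<chi> i. inverse (\<tau> $ i))"

lemma \<tau>_nonzero: "\<tau> $ i \<noteq> 0"
  using torsion_nonzero[OF \<tau>] .

lemma \<tau>_\<sigma>: "\<tau> * \<sigma> = 1"
  by (simp add: vec_eq_iff \<sigma>_def \<tau>_nonzero)

lemma mono_at_\<sigma>_nonzero: "mono_at m \<sigma> \<noteq> 0"
  by (rule mono_at_nonzero) (simp add: \<sigma>_def \<tau>_nonzero)

lemma lookup_form: "m \<in> keys f \<Longrightarrow> c * lookup f m = ipoly (p m) \<zeta> * mono_at m \<sigma>"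
proof -
  assume m: "m \<in> keys f"
  have "mono_at m \<tau> * mono_at m \<sigma> = 1" using mono_at_mult[of m \<tau> \<sigma>] \<tau>_\<sigma> by (simp add: mono_at_1)
  then have "c * lookup f m = c * lookup f m * mono_at m \<tau> * mono_at m \<sigma>" by (simp add: mult.assoc)
  then show ?thesis unfolding form[OF m] .
qed

lemma ipoly_\<zeta>_nonzero: "m \<in> keys f \<Longrightarrow> ipoly (p m) \<zeta> \<noteq> 0"
  using lookup_form[of m] c by (auto simp: in_keys_iff)

lemma f_nonzero: "f \<noteq> 0"
  using irreducible by (simp add: irreducible_def)

lemma keys_nonempty: "\<exists>m. m \<in> keys f"
proof -
  have "keys f \<noteq> {}" using f_nonzero poly_mapping_sum_single[of f] by auto
  then show ?thesis by blast
qed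

text \<open>For \<open>N = 2 * k\<close> with \<open>k\<close> odd, \<open>- \<zeta>\<close> is a
  \<open>k\<close>-th root of unity, so the coefficients could be rewritten at the smaller level
  \<open>k\<close>.\<close>

lemma N_odd_or_4_dvd: "odd N \<or> 4 dvd N"
proof (rule ccontr)
  assume "\<not> ?thesis"
  then obtain k where k: "N = 2 * k" "odd k" by (auto elim!: evenE) 
  then have "k > 0" using N by simp
  have "(- \<zeta>) ^ k = 1"
    using root_of_unity_half[of N] N k by (simp add: power_minus_odd)
  then obtain l where l: "- \<zeta> = root_of_unity k ^ l" using root_of_unity_exhaust \<open>k > 0\<close> by blast
  have "has_cyclotomic_form f k"
    unfolding has_cyclotomic_form_def
  proof (intro conjI exI)
    show "\<forall>m\<in>keys f. c * lookup f m * mono_at m \<tau> =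
        ipoly (pcompose (p m) (monom (- 1) l)) (root_of_unity k)"
      using form by (simp flip: l)
  qed (use \<open>k > 0\<close> c \<tau> in simp_all)
  then show False using minimal k \<open>k > 0\<close> by fastforce
qed

text \<open>The elements \<open>ipoly (p m) \<zeta>\<close> and the coordinates of
  \<open>w * \<sigma>\<close> are integer polynomials in one primitive \<open>L\<close>-th root of
  unity. The sum over each class of characters of \<open>H\<close> is conjugated by raising that
  root to the power \<open>j\<close>; the point \<open>x\<close> stays as it is.\<close>

lemma vanishing_conjugate:
  assumes w: "\<And>x. x \<in> H \<Longrightarrow> poly_eval f (w * x) = 0"
    and H: "1 \<in> H" "\<And>x y. x \<in> H \<Longrightarrow> y \<in> H \<Longrightarrow> x * y \<in> H"
    and L: "L > 0" "N dvd L" "\<And>i. (w * \<sigma>) $ i ^ L = 1"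
    and j: "j > 0" "coprime j L" and x: "x \<in> H"
  shows "(\<Sum>m\<in>keys f. ipoly (p m) (\<zeta> ^ j) * mono_at m (w * \<sigma>) ^ j * mono_at m x) = 0"
proof -
  let ?\<xi> = "root_of_unity L"
  have "\<exists>k. (w * \<sigma>) $ i = ?\<xi> ^ k" for i
    using root_of_unity_exhaust L(1) L(3)[of i] by blast
  then obtain k where k: "\<And>i. (w * \<sigma>) $ i = ?\<xi> ^ k i" by metis
  define e where "e = (\<lambda>m. \<Sum>i\<in>UNIV. k i * lookup m i)"
  have e: "mono_at m (w * \<sigma>) = ?\<xi> ^ e m" for m
    by (simp only: mono_at_def e_def k power_mult power_sum)
  \<comment> \<open>For \<open>m\<close> in \<open>keys f\<close>, its value at
    \<open>?\<xi>\<close> is \<open>c\<close> times the coefficient of \<open>f\<close> times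
    \<open>mono_at m w\<close>; its value at \<open>?\<xi> ^ j\<close> is the conjugate.\<close>
  define q where "q = (\<lambda>m. pcompose (p m) (monom 1 (L div N)) * monom 1 (e m))"
  have \<zeta>: "\<zeta> = ?\<xi> ^ (L div N)" using root_of_unity_dvd L by blast
  have q1: "ipoly (q m) ?\<xi> = ipoly (p m) \<zeta> * mono_at m (w * \<sigma>)" for m
    by (simp add: q_def e \<zeta>)
  have "(?\<xi> ^ j) ^ (L div N) = \<zeta> ^ j" "(?\<xi> ^ j) ^ e m = mono_at m (w * \<sigma>) ^ j" for m
    unfolding \<zeta> e power_mult[symmetric] by (simp_all only: mult.commute)
  then have qj: "ipoly (q m) (?\<xi> ^ j) = ipoly (p m) (\<zeta> ^ j) * mono_at m (w * \<sigma>) ^ j" for m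
    by (simp add: q_def)
  have "(\<Sum>m\<in>keys f. ipoly (q m) (?\<xi> ^ j) * mono_at m x) = 0"
  proof (rule character_sum_transfer[OF _ H(2) _ H(1)])
    show "(\<Sum>m\<in>A. ipoly (q m) (?\<xi> ^ j)) = 0" if "(\<Sum>m\<in>A. ipoly (q m) ?\<xi>) = 0" for A
      using ipoly_conjugate[of ?\<xi> L j "\<Sum>m\<in>A. q m"] that L(1) j by simp
    show "(\<Sum>m\<in>keys f. ipoly (q m) ?\<xi> * mono_at m y) = 0" if y: "y \<in> H" for y
    proof -
      have "ipoly (q m) ?\<xi> = c * (lookup f m * mono_at m w)" if "m \<in> keys f" for m
        unfolding q1 using lookup_form[OF that] by (simp add: mono_at_mult mult_ac)
      then have "(\<Sum>m\<in>keys f. ipoly (q m) ?\<xi> * mono_at m y) =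
          (\<Sum>m\<in>keys f. c * (lookup f m * mono_at m (w * y)))"
        by (intro sum.cong refl) (simp add: mono_at_mult mult_ac)
      also have "\<dots> = c * poly_eval f (w * y)" by (simp add: poly_eval_keys sum_distrib_left)
      finally show ?thesis using w[OF y] by simp
    qed
  qed (use x in \<open>simp_all add: mono_at_mult mono_at_1\<close>)
  then show ?thesis by (simp add: qj)
qed

section \<open>Conjugates of the polynomial and non-divisibility\<close>

text \<open>Conjugation acts on the translated coefficients; the factor
  \<open>mono_at m \<sigma>\<close> undoes the translation afterwards and is not conjugated.\<close>

definition negated :: "'n set \<Rightarrow> 'n mpoly" where
  "negated E = (\<Sum>m\<in>keys f. single m (ipoly (p m) (- \<zeta>) * sign_at E m * mono_at m \<sigma>))"

text \<open>The variables are squared along with \<open>\<zeta>\<close>, so undoing the translation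
  takes the exponent \<open>m + m\<close> as well.\<close>

definition squared :: "'n set \<Rightarrow> 'n mpoly" where
  "squared E = (\<Sum>m\<in>keys f. single (m + m) (ipoly (p m) (\<zeta>\<^sup>2) * sign_at E m * mono_at (m + m) \<sigma>))"

lemma lookup_negated:
  "m \<in> keys f \<Longrightarrow> lookup (negated E) m = ipoly (p m) (- \<zeta>) * sign_at E m * mono_at m \<sigma>"
  unfolding negated_def
  using lookup_sum_single[of "keys f" "\<lambda>m. m" "\<lambda>m. ipoly (p m) (- \<zeta>) * sign_at E m * mono_at m \<sigma>" m]
  by (simp add: inj_def)

lemma inj_double: "inj (\<lambda>m :: 'n \<Rightarrow>\<^sub>0 nat. m + m)"
proof (rule injI)
  fix a b :: "'n \<Rightarrow>\<^sub>0 nat" assume eq: "a + a = b + b"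
  show "a = b"
  proof (rule poly_mapping_eqI)
    fix i
    show "lookup a i = lookup b i" using arg_cong[OF eq, of "\<lambda>m. lookup m i"] by (simp add: lookup_add)
  qed
qed

lemma lookup_squared:
  "m \<in> keys f \<Longrightarrow> lookup (squared E) (m + m) = ipoly (p m) (\<zeta>\<^sup>2) * sign_at E m * mono_at (m + m) \<sigma>"
  unfolding squared_def
  using lookup_sum_single[of "keys f" "\<lambda>m. m + m"
      "\<lambda>m. ipoly (p m) (\<zeta>\<^sup>2) * sign_at E m * mono_at (m + m) \<sigma>" m] inj_double
  by simp

lemma total_degree_negated: "total_degree (negated E) \<le> total_degree f"
  unfolding negated_def by (intro total_degree_sum_single_le mdeg_le_total_degree)

lemma total_degree_squared: "total_degree (squared E) \<le> 2 * total_degree f"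
  unfolding squared_def
proof (rule total_degree_sum_single_le)
  fix m assume "m \<in> keys f"
  then show "mdeg (m + m) \<le> 2 * total_degree f" using mdeg_le_total_degree[of m f] by (simp add: mdeg_add)
qed

text \<open>With \<open>N = 4 * k\<close>, the exponent \<open>1 + 2 * k\<close> is coprime to
  \<open>N\<close> and sends \<open>- \<zeta>\<close> to \<open>\<zeta>\<close>, so the two are
  conjugate.\<close>

lemma ipoly_neg_\<zeta>_nonzero:
  assumes "4 dvd N" "m \<in> keys f"
  shows "ipoly (p m) (- \<zeta>) \<noteq> 0"
proof
  assume 0: "ipoly (p m) (- \<zeta>) = 0"
  obtain k where k: "N = 4 * k" using assms(1) by blast
  have k0: "k > 0" using N k by simp
  let ?j = "1 + 2 * k"
  have \<zeta>: "\<zeta> ^ (2 * k) = - 1" using root_of_unity_half[of N] N k by simp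
  have "(- \<zeta>) ^ N = 1" using N k by simp
  moreover have "coprime ?j N"
  proof -
    have "coprime ?j 2" by simp
    moreover have "coprime ?j (2 * k)" by (metis coprime_add_one_left add.commute)
    ultimately have "coprime ?j (2 * (2 * k))" by (simp only: coprime_mult_right_iff) 
    then show ?thesis using k by simp
  qed
  ultimately have "ipoly (p m) ((- \<zeta>) ^ ?j) = 0"
    using ipoly_conjugate[OF _ N _ _ 0, of ?j] by simp
  moreover have "(- \<zeta>) ^ ?j = \<zeta>" using \<zeta> by (simp add: power_add)
  ultimately show False using ipoly_\<zeta>_nonzero[OF assms(2)] by simp
qed

text \<open>With \<open>N = 2 * k + 1\<close>, the exponent \<open>k + 1\<close> is coprime to
  \<open>N\<close> and sends \<open>\<zeta>\<^sup>2\<close> back to \<open>\<zeta>\<close>.\<close>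

lemma ipoly_square_\<zeta>_nonzero:
  assumes "odd N" "m \<in> keys f"
  shows "ipoly (p m) (\<zeta>\<^sup>2) \<noteq> 0"
proof
  assume 0: "ipoly (p m) (\<zeta>\<^sup>2) = 0"
  obtain k where k: "N = 2 * k + 1" using assms(1) by (rule oddE)
  have "(\<zeta>\<^sup>2) ^ N = 1" using N by (metis power_commutes power_mult mult.commute power_one root_of_unity_power_self)
  moreover have "coprime (k + 1) N"
  proof -
    have "N = (k + 1) + k" using k by simp
    moreover have "coprime (k + 1) k" by simp
    ultimately show ?thesis by (metis coprime_iff_gcd_eq_1 gcd_add2)
  qed
  ultimately have "ipoly (p m) ((\<zeta>\<^sup>2) ^ (k + 1)) = 0"
    using ipoly_conjugate[OF _ N _ _ 0, of "k + 1"] by simp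
  moreover have "(\<zeta>\<^sup>2) ^ (k + 1) = \<zeta> ^ (N + 1)" unfolding power_mult[symmetric] using k by (simp add: algebra_simps)
  moreover have "\<zeta> ^ (N + 1) = \<zeta>" using N by simp
  ultimately have "ipoly (p m) \<zeta> = 0" by metis
  then show False using ipoly_\<zeta>_nonzero[OF assms(2)] by simp
qed

text \<open>If \<open>f\<close> divided this polynomial, a torsion translate of a multiple of \<open>f\<close> would have coefficients
  invariant under \<open>\<zeta> \<mapsto> - \<zeta>\<close>, hence in the ring generated by \<open>\<zeta>\<^sup>2\<close>, against the minimality of \<open>N\<close>.\<close>

lemma not_dvd_negated:
  assumes "4 dvd N"
  shows "\<not> f dvd negated E"
proof
  assume dvd: "f dvd negated E"
  obtain m0 where m0: "m0 \<in> keys f" using keys_nonempty by blast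
  have "lookup (negated E) m0 \<noteq> 0"
    using lookup_negated[OF m0] ipoly_neg_\<zeta>_nonzero[OF assms m0] sign_at_nonzero mono_at_\<sigma>_nonzero by simp
  then have "negated E \<noteq> 0" by auto
  then obtain k0 where k0: "\<And>m. lookup (negated E) m = k0 * lookup f m"
    using dvd_total_degree_le[OF dvd _ total_degree_negated] by blast
  define k where "k = k0 / c"
  have k: "ipoly (p m) (- \<zeta>) * sign_at E m = k * ipoly (p m) \<zeta>" if m: "m \<in> keys f" for m
  proof -
    have "ipoly (p m) (- \<zeta>) * sign_at E m * mono_at m \<sigma> * c = k0 * (c * lookup f m)"
      using k0[of m] lookup_negated[OF m, of E] by simp
    also have "\<dots> = k0 * ipoly (p m) \<zeta> * mono_at m \<sigma>" using lookup_form[OF m] by simp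
    finally show ?thesis using c mono_at_\<sigma>_nonzero[of m] by (simp add: k_def field_simps)
  qed
  let ?e = "\<lambda>m. \<Sum>i\<in>E. lookup m i"
  have sgn: "(- \<zeta>) ^ ?e m = sign_at E m * \<zeta> ^ ?e m" for m
    unfolding sign_at_def by (rule power_minus)
  \<comment> \<open>The factor from \<open>m0\<close> cancels the constant \<open>k\<close> and the
    powers of \<open>z\<close> absorb the signs, so that \<open>q m\<close> takes equal values at
    \<open>\<zeta>\<close> and \<open>- \<zeta>\<close> for \<open>m\<close> in
    \<open>keys f\<close>.\<close>
  define q where "q = (\<lambda>m. p m * pcompose (p m0) [:0, - 1:] * monom 1 (?e m) * monom 1 (?e m0))"
  have q: "ipoly (q m) z = ipoly (p m) z * ipoly (p m0) (- z) * z ^ ?e m * z ^ ?e m0" for m z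
    by (simp add: q_def)
  have even: "ipoly (q m) (- \<zeta>) = ipoly (q m) \<zeta>" if m: "m \<in> keys f" for m
  proof -
    have "ipoly (q m) (- \<zeta>) = (ipoly (p m) (- \<zeta>) * sign_at E m) * ipoly (p m0) \<zeta> * \<zeta> ^ ?e m *
        (sign_at E m0 * \<zeta> ^ ?e m0)"
      unfolding q sgn by simp
    also have "\<dots> = ipoly (p m) \<zeta> * (k * ipoly (p m0) \<zeta> * sign_at E m0) * \<zeta> ^ ?e m * \<zeta> ^ ?e m0"
      unfolding k[OF m] by (simp only: mult_ac)
    also have "k * ipoly (p m0) \<zeta> * sign_at E m0 = ipoly (p m0) (- \<zeta>)"
      unfolding k[OF m0, symmetric] by (simp add: mult.assoc sign_at_square)
    finally show ?thesis unfolding q .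
  qed
  have "\<exists>r. ipoly (q m) \<zeta> = ipoly r (\<zeta>\<^sup>2)" if "m \<in> keys f" for m
    using ipoly_even[OF even[OF that]] .
  then obtain r where r: "\<And>m. m \<in> keys f \<Longrightarrow> ipoly (q m) \<zeta> = ipoly (r m) (\<zeta>\<^sup>2)" by metis
  define M where "M = N div 2"
  have NM: "N = M * 2" "M > 0" "M < N" using assms N by (auto simp: M_def)
  have \<zeta>2: "\<zeta>\<^sup>2 = root_of_unity M" using root_of_unity_mult[of 2 M] NM by simp
  \<comment> \<open>This translation accounts for the factor \<open>\<zeta> ^ ?e m\<close> of
    \<open>q m\<close>; the factors that depend on \<open>m0\<close> alone go into the
    scalar.\<close>
  define \<tau>' where "\<tau>' = (\<chi> i. \<tau> $ i * (if i \<in> E then \<zeta> else 1))"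
  have mono_\<tau>': "mono_at m \<tau>' = mono_at m \<tau> * \<zeta> ^ ?e m" for m
  proof -
    have "(\<Prod>i\<in>UNIV. (if i \<in> E then \<zeta> else 1) ^ lookup m i) = (\<Prod>i\<in>UNIV. if i \<in> E then \<zeta> ^ lookup m i else 1)"
      by (intro prod.cong) auto
    also have "\<dots> = (\<Prod>i\<in>E. \<zeta> ^ lookup m i)" by (simp add: prod.If_cases)
    finally show ?thesis
      by (simp add: mono_at_def \<tau>'_def power_mult_distrib prod.distrib power_sum)
  qed
  have \<zeta>0: "\<zeta> \<noteq> 0" by (simp add: root_of_unity_def)
  have "has_cyclotomic_form f M"
    unfolding has_cyclotomic_form_def
  proof (intro conjI exI)
    show "M > 0" by fact
    show "c * ipoly (p m0) (- \<zeta>) * \<zeta> ^ ?e m0 \<noteq> 0"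
      using c ipoly_neg_\<zeta>_nonzero[OF assms m0] \<zeta>0 by simp
    show "\<forall>i. \<exists>k>0. \<tau>' $ i ^ k = 1"
    proof
      fix i
      obtain l where l: "l > 0" "\<tau> $ i ^ l = 1" using \<tau> by blast
      have "(if i \<in> E then \<zeta> else 1) ^ N = 1" using N by simp
      then have "\<tau>' $ i ^ (l * N) = (\<tau> $ i ^ l) ^ N * ((if i \<in> E then \<zeta> else 1) ^ N) ^ l"
        unfolding \<tau>'_def vec_lambda_beta power_mult_distrib power_mult[symmetric] by (simp only: mult.commute)
      then have "\<tau>' $ i ^ (l * N) = 1" using l(2) \<open>(if i \<in> E then \<zeta> else 1) ^ N = 1\<close> by simp
      then show "\<exists>k>0. \<tau>' $ i ^ k = 1" using l(1) N by (intro exI[of _ "l * N"]) simp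
    qed
    show "\<forall>m\<in>keys f. c * ipoly (p m0) (- \<zeta>) * \<zeta> ^ ?e m0 * lookup f m * mono_at m \<tau>' =
        ipoly (r m) (root_of_unity M)"
    proof
      fix m assume m: "m \<in> keys f"
      have "c * ipoly (p m0) (- \<zeta>) * \<zeta> ^ ?e m0 * lookup f m * mono_at m \<tau>' =
          (c * lookup f m * mono_at m \<tau>) * ipoly (p m0) (- \<zeta>) * \<zeta> ^ ?e m * \<zeta> ^ ?e m0"
        unfolding mono_\<tau>' by (simp only: mult_ac)
      also have "\<dots> = ipoly (q m) \<zeta>" unfolding form[OF m] q ..
      finally show "c * ipoly (p m0) (- \<zeta>) * \<zeta> ^ ?e m0 * lookup f m * mono_at m \<tau>' =
          ipoly (r m) (root_of_unity M)" using r[OF m] \<zeta>2 by simp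
    qed
  qed
  then show False using minimal NM(3) by fastforce
qed

text \<open>Squaring the variables makes this polynomial invariant under all sign changes \<open>\<delta>\<close>. If \<open>f\<close> divided it,
  with cofactor \<open>h\<close>, then \<open>h\<close> would be proportional to \<open>f(\<delta> X)\<close> for every \<open>\<delta> \<noteq> 1\<close>; there
  are at least three such \<open>\<delta>\<close>.\<close>

lemma not_dvd_squared:
  assumes "odd N" and n: "CARD('n) \<ge> 2"
  shows "\<not> f dvd squared E"
proof
  assume "f dvd squared E"
  then obtain h where h: "squared E = f * h" by (rule dvdE)
  obtain m0 where m0: "m0 \<in> keys f" using keys_nonempty by blast
  have "lookup (squared E) (m0 + m0) \<noteq> 0"
    using lookup_squared[OF m0] ipoly_square_\<zeta>_nonzero[OF assms(1) m0] sign_at_nonzero mono_at_\<sigma>_nonzero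
    by simp
  then have "squared E \<noteq> 0" by auto
  then have h0: "h \<noteq> 0" using h by auto
  have degh: "total_degree h \<le> total_degree f"
    using total_degree_squared[of E] total_degree_mult[OF f_nonzero h0] h by simp
  have "\<exists>k. k \<noteq> 0 \<and> (\<forall>m. sign_at D m * lookup h m = k * lookup f m)" if D: "D \<noteq> {}" for D
  proof -
    let ?s = "scale_coeffs (sign_at D)"
    \<comment> \<open>All exponents of \<open>squared E\<close> have the form \<open>m + m\<close>,
      where the sign is trivial.\<close>
    have "?s (squared E) = squared E"
    proof -
      have "?s (squared E) = (\<Sum>m\<in>keys f. ?s (single (m + m) (ipoly (p m) (\<zeta>\<^sup>2) * sign_at E m * mono_at (m + m) \<sigma>)))"
        unfolding squared_def by (rule scale_coeffs_sum)
      also have "\<dots> = squared E"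
        unfolding squared_def scale_coeffs_single sign_at_add sign_at_square by simp
      finally show ?thesis .
    qed
    then have "squared E = ?s f * ?s h" unfolding h by (simp add: scale_coeffs_mult sign_at_add)
    then have "f dvd ?s f * ?s h" using h by (metis dvd_triv_left)
    \<comment> \<open>\<open>f\<close> divides the product of the two sign-changed factors but not
      its own sign change, so it divides that of \<open>h\<close>.\<close>
    then have dvd: "f dvd ?s h"
      using mpoly_irreducible_dvd_mult[OF irreducible] not_dvd_scale_sign[OF lattice f_nonzero D] by blast
    have keys: "keys (?s h) = keys h" by (auto simp: in_keys_iff sign_at_nonzero)
    then have "?s h \<noteq> 0" using h0 by (metis keys_zero poly_mapping_sum_single sum.empty)
    moreover have "total_degree (?s h) \<le> total_degree f" using degh by (simp add: total_degree_def keys)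
    ultimately show ?thesis using dvd_total_degree_le[OF dvd] by simp
  qed
  note * = this
  obtain i j :: 'n where ij: "i \<noteq> j"
  proof -
    have "\<not> (\<forall>i j :: 'n. i = j)"
    proof
      assume "\<forall>i j :: 'n. i = j"
      then have "(UNIV :: 'n set) \<subseteq> {undefined}" by blast
      then have "CARD('n) \<le> card {undefined :: 'n}" by (intro card_mono) simp_all
      then show False using n by simp
    qed
    then show thesis using that by blast
  qed
  obtain k where k: "k \<noteq> 0" "\<And>m. sign_at {i} m * lookup h m = k * lookup f m" using *[of "{i}"] by blast
  obtain l where l: "l \<noteq> 0" "\<And>m. sign_at {j} m * lookup h m = l * lookup f m" using *[of "{j}"] by blast
  \<comment> \<open>After the sign change at \<open>i\<close>, and likewise at \<open>j\<close>,
    \<open>h\<close> is proportional to \<open>f\<close>; comparing the two makes the sign for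
    \<open>{i, j}\<close> constant on the support.\<close>
  have "sign_at {i, j} m = l / k" if m: "m \<in> keys f" for m
  proof -
    have h_eq: "lookup h m = sign_at {i} m * (k * lookup f m)"
      unfolding k(2)[symmetric] by (simp add: sign_at_square flip: mult.assoc)
    have "sign_at {j} m * (sign_at {i} m * (k * lookup f m)) = l * lookup f m"
      using l(2)[of m] unfolding h_eq .
    moreover have "sign_at {i, j} m = sign_at {i} m * sign_at {j} m"
      unfolding insert_is_Un[of i "{j}"] by (rule sign_at_disjoint) (use ij in simp_all)
    ultimately have "(sign_at {i, j} m * k) * lookup f m = l * lookup f m" by (simp add: mult_ac)
    then have "sign_at {i, j} m * k = l" using m by (simp add: in_keys_iff)
    then show ?thesis using k(1) by (simp add: field_simps)
  qed
  then have "{i, j} = {}" by (rule sign_at_const_on_keys[OF lattice])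
  then show False by simp
qed

section \<open>The family of witnesses and the torsion cosets it covers\<close>

definition witnesses :: "'n mpoly set" where
  "witnesses = (\<lambda>E. scale_coeffs (sign_at E) f) ` (UNIV - {{}}) \<union>
     (if 4 dvd N then range negated else range squared)"

text \<open>The trivial sign change would return \<open>f\<close> and is left out of the first
  family only, which gives \<open>(2 ^ n - 1) + 2 ^ n\<close>.\<close>

lemma card_witnesses: "card witnesses \<le> 2 ^ (CARD('n) + 1) - 1"
proof -
  have pow: "card (UNIV :: 'n set set) = 2 ^ CARD('n)" by (simp add: card_Pow flip: Pow_UNIV)
  have "card ((\<lambda>E. scale_coeffs (sign_at E) f) ` (UNIV - {{}})) \<le> card (UNIV - {{}} :: 'n set set)"
    by (rule card_image_le) simp
  also have "\<dots> = 2 ^ CARD('n) - 1" using pow by (simp add: card_Diff_subset)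
  finally have 1: "card ((\<lambda>E. scale_coeffs (sign_at E) f) ` (UNIV - {{}})) \<le> 2 ^ CARD('n) - 1" .
  have 2: "card (if 4 dvd N then range negated else range squared) \<le> 2 ^ CARD('n)"
    using card_image_le[of UNIV negated] card_image_le[of UNIV squared] pow by simp
  have "card witnesses \<le> (2 ^ CARD('n) - 1) + 2 ^ CARD('n)"
    unfolding witnesses_def using card_Un_le add_mono[OF 1 2] le_trans by blast
  also have "\<dots> = 2 ^ (CARD('n) + 1) - (1::nat)" using one_le_power[of "2::nat" "CARD('n)"] by simp
  finally show ?thesis .
qed

lemma total_degree_witnesses: "F \<in> witnesses \<Longrightarrow> total_degree F \<le> 2 * total_degree f"
proof -
  assume "F \<in> witnesses"
  then consider E where "F = scale_coeffs (sign_at E) f" | E where "F = negated E" | E where "F = squared E"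
    unfolding witnesses_def by (auto split: if_splits)
  then show ?thesis
  proof cases
    case 1
    have "keys (scale_coeffs (sign_at E) f) = keys f" for E by (auto simp: in_keys_iff sign_at_nonzero)
    then have "total_degree F = total_degree f" by (simp add: 1 total_degree_def)
    then show ?thesis by simp
  next
    case 2
    then show ?thesis using total_degree_negated[of E] by simp
  next
    case 3
    then show ?thesis using total_degree_squared[of E] by simp
  qed
qed

lemma not_dvd_witnesses:
  assumes "CARD('n) \<ge> 2" "F \<in> witnesses"
  shows "\<not> f dvd F"
proof -
  consider E where "E \<noteq> {}" "F = scale_coeffs (sign_at E) f" | E where "4 dvd N" "F = negated E"
    | E where "\<not> 4 dvd N" "F = squared E"
    using assms(2) unfolding witnesses_def by (auto split: if_splits)
  then show ?thesis
  proof cases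
    case 1
    then show ?thesis using not_dvd_scale_sign[OF lattice f_nonzero] by blast
  next
    case 2
    then show ?thesis using not_dvd_negated by blast
  next
    case 3
    then show ?thesis using not_dvd_squared[OF _ assms(1)] N_odd_or_4_dvd by blast
  qed
qed

text \<open>An exponent \<open>j\<close> coprime to \<open>L\<close> is chosen so that the
  \<open>j\<close>-th power of \<open>u\<close> is \<open>u\<close> or its square up to signs; the
  conjugated relation then says that a witness vanishes on \<open>C\<close>. If 4 divides
  \<open>L\<close>, \<open>j\<close> is \<open>1 + L div 2\<close>; otherwise \<open>N\<close> is
  odd and \<open>j\<close> is 2 or \<open>2 + L div 2\<close>.\<close>

lemma torsion_coset_covered:
  assumes C: "torsion_coset C" "C \<subseteq> hypersurface f"
  shows "\<exists>F\<in>witnesses. C \<subseteq> hypersurface F"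
proof -
  obtain w H where w: "\<And>i. \<exists>k>0. (w $ i) ^ k = 1"
    and H: "1 \<in> H" "\<And>x y. x \<in> H \<Longrightarrow> y \<in> H \<Longrightarrow> x * y \<in> H" "\<And>x i. x \<in> H \<Longrightarrow> x $ i \<noteq> 0"
    and CwH: "C = {w * x | x. x \<in> H}" and van: "\<And>x. x \<in> H \<Longrightarrow> poly_eval f (w * x) = 0"
    using torsion_cosetE[OF C] by blast
  define u where "u = w * \<sigma>"
  \<comment> \<open>\<open>L\<close> is taken least among the positive multiples of \<open>N\<close>
    that annihilate \<open>u\<close>; minimality will make a sign vector nontrivial.\<close>
  define P where "P = (\<lambda>L. L > 0 \<and> N dvd L \<and> (\<forall>i. u $ i ^ L = 1))"
  have "\<exists>L. P L"
  proof -
    obtain a where a: "a > 0" "\<forall>i. w $ i ^ a = 1" using torsion_exponent[OF w] by blast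
    obtain b where b: "b > 0" "\<forall>i. \<tau> $ i ^ b = 1" using torsion_exponent[OF \<tau>] by blast
    have "u $ i ^ (N * (a * b)) = 1" for i
    proof -
      have 1: "w $ i ^ (N * (a * b)) = 1"
        using a(2) by (metis mult.assoc mult.commute power_mult power_one)
      have "\<tau> $ i ^ (N * (a * b)) = 1"
        using b(2) by (metis mult.assoc mult.commute power_mult power_one)
      then show ?thesis using 1 by (simp add: u_def \<sigma>_def power_mult_distrib power_inverse)
    qed
    then have "P (N * (a * b))" using a(1) b(1) N by (simp add: P_def)
    then show ?thesis by blast
  qed
  then obtain L where PL: "P L" and Lmin: "\<And>M. P M \<Longrightarrow> L \<le> M"
    by (metis LeastI_ex Least_le)
  have L: "L > 0" "N dvd L" "\<And>i. u $ i ^ L = 1" using PL by (auto simp: P_def)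
  have sum: "(\<Sum>m\<in>keys f. ipoly (p m) (\<zeta> ^ j) * mono_at m u ^ j * mono_at m x) = 0"
    if "j > 0" "coprime j L" "x \<in> H" for j x
    unfolding u_def by (rule vanishing_conjugate[OF van H(1,2) L(1,2) _ that]) (use L(3) u_def in blast)+
  have u_half: "u $ i ^ (L div 2) = 1 \<or> u $ i ^ (L div 2) = - 1" if "even L" for i
  proof -
    have "(u $ i ^ (L div 2))\<^sup>2 = 1" using L(3)[of i] that by (simp flip: power_mult)
    then show ?thesis by (simp add: power2_eq_1_iff)
  qed
  define E where "E = {i. u $ i ^ (L div 2) \<noteq> 1}"
  have mono_half: "mono_at m u ^ (L div 2) = sign_at E m" if "even L" for m
    unfolding mono_at_power E_def using mono_at_sign[of "\<chi> i. u $ i ^ (L div 2)" m] u_half[OF that] by simp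
  have covered: "\<exists>F\<in>witnesses. C \<subseteq> hypersurface F"
    if "F \<in> witnesses" "\<And>x. x \<in> H \<Longrightarrow> poly_eval F (w * x) = 0" for F
    using that coset_subset_hypersurface[OF w H(3) that(2)] unfolding CwH by blast
  show ?thesis
  proof (cases "4 dvd L")
    case True
    then obtain k where k: "L = 4 * k" by blast
    have L2: "L div 2 = 2 * k" "even L" "k > 0" using k L(1) by auto
    let ?j = "1 + L div 2"
    have "coprime ?j L"
    proof -
      have "coprime ?j 2" using L2 by simp
      moreover have "coprime ?j (2 * k)" unfolding L2(1) by (metis coprime_add_one_left add.commute)
      ultimately have "coprime ?j (2 * (2 * k))" by (simp only: coprime_mult_right_iff)
      then show ?thesis using k by simp
    qed
    note sum' = sum[OF _ this]
    have mono: "mono_at m u ^ ?j = mono_at m u * sign_at E m" for m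
      using mono_half[OF L2(2)] by (simp add: power_add)
    show ?thesis
    proof (cases "N dvd L div 2")
      case True
      then have \<zeta>: "\<zeta> ^ ?j = \<zeta>" using root_of_unity_power_eq_1[OF N, of "L div 2"] by (simp add: power_add)
      \<comment> \<open>With trivial signs, \<open>L div 2\<close> would do in place of
        \<open>L\<close>.\<close>
      have "E \<noteq> {}"
      proof
        assume "E = {}"
        then have "P (L div 2)" using True L2 by (auto simp: P_def E_def)
        then show False using Lmin[of "L div 2"] L2 k by simp
      qed
      then have "scale_coeffs (sign_at E) f \<in> witnesses" by (auto simp: witnesses_def)
      moreover have "poly_eval (scale_coeffs (sign_at E) f) (w * x) = 0" if x: "x \<in> H" for x
      proof -
        have keys: "keys (scale_coeffs (sign_at E) f) = keys f" by (auto simp: in_keys_iff sign_at_nonzero)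
        have "c * poly_eval (scale_coeffs (sign_at E) f) (w * x) =
            (\<Sum>m\<in>keys f. (c * lookup f m) * (sign_at E m * (mono_at m w * mono_at m x)))"
          by (simp add: poly_eval_keys keys mono_at_mult sum_distrib_left mult_ac)
        also have "\<dots> = (\<Sum>m\<in>keys f. ipoly (p m) (\<zeta> ^ ?j) * mono_at m u ^ ?j * mono_at m x)"
          unfolding \<zeta> mono by (intro sum.cong refl) (simp add: lookup_form u_def mono_at_mult mult_ac)
        also have "\<dots> = 0" by (rule sum') (use x in simp_all)
        finally show ?thesis using c by simp
      qed
      ultimately show ?thesis by (rule covered)
    next
      case False
      have "\<zeta> ^ L = 1" using root_of_unity_power_eq_1[OF N] L(2) by blast
      then have "(\<zeta> ^ (L div 2))\<^sup>2 = 1" using L2(2) by (metis dvd_div_mult_self power_mult)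
      then have "\<zeta> ^ (L div 2) = - 1" using False root_of_unity_power_eq_1[OF N] by (simp add: power2_eq_1_iff)
      then have \<zeta>: "\<zeta> ^ ?j = - \<zeta>" by (simp add: power_add)
      have "even N"
      proof (rule ccontr)
        assume "odd N"
        then have "coprime N 2" by simp
        moreover have "N dvd 2 * (L div 2)" using L(2) L2(2) by simp
        ultimately show False using False by (simp add: coprime_dvd_mult_right_iff)
      qed
      then have "negated E \<in> witnesses" using N_odd_or_4_dvd by (auto simp: witnesses_def)
      moreover have "poly_eval (negated E) (w * x) = 0" if x: "x \<in> H" for x
      proof -
        have "poly_eval (negated E) (w * x) =
            (\<Sum>m\<in>keys f. ipoly (p m) (- \<zeta>) * sign_at E m * mono_at m \<sigma> * mono_at m (w * x))"
          unfolding negated_def by (simp add: poly_eval_sum_single)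
        also have "\<dots> = (\<Sum>m\<in>keys f. ipoly (p m) (\<zeta> ^ ?j) * mono_at m u ^ ?j * mono_at m x)"
          unfolding \<zeta> mono by (intro sum.cong refl) (simp add: u_def mono_at_mult mult_ac)
        also have "\<dots> = 0" by (rule sum') (use x in simp_all)
        finally show ?thesis .
      qed
      ultimately show ?thesis by (rule covered)
    qed
  next
    case False
    then have nN: "\<not> 4 dvd N" using L(2) dvd_trans by blast
    then have oddN: "odd N" using N_odd_or_4_dvd by blast
    \<comment> \<open>For even \<open>L\<close> the exponent 2 is not coprime to \<open>L\<close>;
      since \<open>L div 2\<close> is then odd, adding it repairs this, and it leaves
      \<open>\<zeta>\<^sup>2\<close> unchanged because the odd number \<open>N\<close> divides
      \<open>L div 2\<close>.\<close>
    define t where "t = (if odd L then 0 else L div 2)"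
    have "coprime (2 + t) L"
    proof (cases "odd L")
      case False
      then obtain k where k: "L = 2 * k" by blast
      then have "odd k" using \<open>\<not> 4 dvd L\<close> by auto
      then have "coprime (2 + k) 2" by simp
      moreover have "coprime (2 + k) k"
        using \<open>odd k\<close> by (metis coprime_iff_gcd_eq_1 coprime_left_2_iff_odd gcd_add1)
      ultimately show ?thesis using k by (simp add: t_def)
    qed (simp add: t_def)
    note sum' = sum[OF _ this]
    have "N dvd t"
    proof (cases "odd L")
      case False
      have "coprime N 2" using oddN by simp
      moreover have "N dvd 2 * (L div 2)" using L(2) False by simp
      ultimately show ?thesis using False by (simp add: t_def coprime_dvd_mult_right_iff)
    qed (simp add: t_def)
    then have \<zeta>: "\<zeta> ^ (2 + t) = \<zeta>\<^sup>2" using root_of_unity_power_eq_1[OF N, of t] by (simp add: power_add power2_eq_square)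
    define D where "D = (if odd L then {} else E)"
    have "mono_at m u ^ t = sign_at D m" for m
      using mono_half[of m] by (simp add: t_def D_def sign_at_def)
    then have mono: "mono_at m u ^ (2 + t) = mono_at (m + m) u * sign_at D m" for m
      by (simp add: power_add mono_at_add power2_eq_square)
    have "squared D \<in> witnesses" using nN by (simp add: witnesses_def)
    moreover have "poly_eval (squared D) (w * x) = 0" if x: "x \<in> H" for x
    proof -
      have "poly_eval (squared D) (w * x) = (\<Sum>m\<in>keys f.
          ipoly (p m) (\<zeta>\<^sup>2) * sign_at D m * mono_at (m + m) \<sigma> * mono_at (m + m) (w * x))"
        unfolding squared_def by (simp add: poly_eval_sum_single)
      \<comment> \<open>The variables are squared, so the conjugated relation is used at the point
        \<open>x * x\<close> of \<open>H\<close>.\<close>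
      also have "\<dots> = (\<Sum>m\<in>keys f. ipoly (p m) (\<zeta> ^ (2 + t)) * mono_at m u ^ (2 + t) * mono_at m (x * x))"
        unfolding \<zeta> mono by (intro sum.cong refl) (simp add: u_def mono_at_mult mono_at_add mult_ac)
      also have "\<dots> = 0" by (rule sum') (use x H(2) in simp_all)
      finally show ?thesis .
    qed
    ultimately show ?thesis by (rule covered)
  qed
qed

end

section \<open>Choice of the least level and enumeration of the witnesses\<close>

theorem theorem3:
  fixes f :: "'n::finite mpoly"
  assumes "CARD('n) \<ge> 2"
    and "irreducible f"
    and "exponent_lattice f = UNIV"
  shows "\<exists>(m::nat) (F :: nat \<Rightarrow> 'n mpoly). 1 \<le> m \<and> m \<le> 2 ^ (CARD('n) + 1) - 1 \<and>
    (\<forall>i\<in>{1..m}. total_degree (F i) \<le> 2 * total_degree f) \<and>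
    (\<forall>i\<in>{1..m}. \<forall>g. g dvd f \<longrightarrow> g dvd F i \<longrightarrow> g dvd 1) \<and>
    (\<forall>C. torsion_coset C \<longrightarrow> C \<subseteq> hypersurface f \<longrightarrow> (\<exists>i\<in>{1..m}. C \<subseteq> hypersurface (F i)))"
proof -
  have "\<exists>W :: 'n mpoly set. finite W \<and> W \<noteq> {} \<and> card W \<le> 2 ^ (CARD('n) + 1) - 1 \<and>
      (\<forall>F\<in>W. total_degree F \<le> 2 * total_degree f \<and> \<not> f dvd F) \<and>
      (\<forall>C. torsion_coset C \<longrightarrow> C \<subseteq> hypersurface f \<longrightarrow> (\<exists>F\<in>W. C \<subseteq> hypersurface F))"
  proof (cases "\<exists>N. has_cyclotomic_form f N")
    case False
    then obtain F where F: "total_degree F \<le> total_degree f" "\<not> f dvd F"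
      "\<forall>C. torsion_coset C \<longrightarrow> C \<subseteq> hypersurface f \<longrightarrow> C \<subseteq> hypersurface F"
      using non_cyclotomic_case[OF assms(2)] by blast
    have "(2::nat) \<le> 2 ^ (CARD('n) + 1)" by simp
    then have "(1::nat) \<le> 2 ^ (CARD('n) + 1) - 1" by linarith
    then show ?thesis using F by (intro exI[of _ "{F}"]) simp
  next
    case True
    define N where "N = (LEAST N. has_cyclotomic_form f N)"
    have "has_cyclotomic_form f N" unfolding N_def using True by (rule LeastI_ex)
    then obtain c \<tau> p where "N > 0" "c \<noteq> 0" "\<forall>i. \<exists>k>0. \<tau> $ i ^ k = 1"
      "\<forall>m\<in>keys f. c * lookup f m * mono_at m \<tau> = ipoly (p m) (root_of_unity N)"
      unfolding has_cyclotomic_form_def by blast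
    then interpret cyclotomic_form f N c \<tau> p
      using assms by unfold_locales (auto simp: N_def intro: Least_le)
    have "finite witnesses" by (simp add: witnesses_def)
    moreover have "witnesses \<noteq> {}" by (simp add: witnesses_def)
    ultimately show ?thesis
      using card_witnesses total_degree_witnesses not_dvd_witnesses[OF assms(1)] torsion_coset_covered
      by (intro exI[of _ witnesses]) blast
  qed
  then obtain W :: "'n mpoly set" where W: "finite W" "W \<noteq> {}" "card W \<le> 2 ^ (CARD('n) + 1) - 1"
    "\<forall>F\<in>W. total_degree F \<le> 2 * total_degree f \<and> \<not> f dvd F"
    "\<forall>C. torsion_coset C \<longrightarrow> C \<subseteq> hypersurface f \<longrightarrow> (\<exists>F\<in>W. C \<subseteq> hypersurface F)"
    by (elim exE conjE)
  obtain F where F: "bij_betw F {1..card W} W" using ex_bij_betw_nat_finite_1[OF W(1)] by blast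
  have FW: "F i \<in> W" if "i \<in> {1..card W}" for i using F that by (rule bij_betwE[THEN bspec])
  show ?thesis
  proof (intro exI conjI ballI allI impI)
    show "1 \<le> card W" using W(1,2) by (simp add: Suc_le_eq card_gt_0_iff)
    show "card W \<le> 2 ^ (CARD('n) + 1) - 1" by fact
    show "total_degree (F i) \<le> 2 * total_degree f" if "i \<in> {1..card W}" for i using W(4) FW[OF that] by blast
    show "g dvd 1" if "i \<in> {1..card W}" "g dvd f" "g dvd F i" for i g
    proof -
      have "\<not> f dvd F i" using W(4) FW[OF that(1)] by blast
      then show ?thesis using irreducible_no_common_factor[OF assms(2) _ that(2,3)] by blast
    qed
    fix C assume "torsion_coset C" "C \<subseteq> hypersurface f"
    then obtain G where "G \<in> W" "C \<subseteq> hypersurface G" using W(5) by blast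
    then have "G \<in> F ` {1..card W}" using bij_betw_imp_surj_on[OF F] by simp
    then show "\<exists>i\<in>{1..card W}. C \<subseteq> hypersurface (F i)"
      using \<open>C \<subseteq> hypersurface G\<close> by (elim imageE) blast
  qed
qed

end
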